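(* Let $n\geq 1$ and let $A\subseteq \mathbb H^n$ be a Lebesgue measurable set of positive Korányi upper density, i.e. $$\limsup_{R\to\infty}\ \sup_{x\in\mathbb H^n}\frac{|A\cap B(x,R)|}{|B(x,R)|}>0.$$ Then there exists $R_0=R_0(A)>0$ such that for every $R\geq R_0$ there exist $x,y\in A$ with $d_K(x,y)=R$.
   Context: The Heisenberg group $\mathbb H^n$ ($n\ge 1$) is $\mathbb C^n\times\mathbb R$ with group law $(z,t)\cdot(w,s)=\big(z+w,\ t+s+\tfrac12\operatorname{Im}(z\cdot\overline w)\big)$, where $z\cdot\overline w=\sum_{j=1}^n z_j\overline{w_j}$; the inverse of $(z,t)$ is $(-z,-t)$. The Haar measure is Lebesgue measure $dz\,dt$ on $\mathbb R^{2n}\times\mathbb R$, and $|S|$ denotes the Haar measure of a set $S$. The Korányi norm is $|(z,t)|_K=(|z|^4+t^2)^{1/4}$, the Korányi distance is $d_K(x,y)=|y^{-1}\cdot x|_K$, and the Korányi ball is $B(a,r)=\{x\in\mathbb H^n: |a^{-1}\cdot x|_K<r\}$. *)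

theory Defs
  imports "HOL-Analysis.Analysis"
begin

type_synonym 'n heis = "(complex ^ 'n) \<times> real"

definition heis_mult :: "'n::finite heis \<Rightarrow> 'n heis \<Rightarrow> 'n heis" where
  "heis_mult p q = (fst p + fst q,
     snd p + snd q + 1/2 * Im (\<Sum>j\<in>UNIV. (fst p $ j) * cnj (fst q $ j)))"

definition heis_inv :: "'n::finite heis \<Rightarrow> 'n heis" where
  "heis_inv p = (- fst p, - snd p)"

definition kor_norm :: "'n::finite heis \<Rightarrow> real" where
  "kor_norm p = root 4 ((norm (fst p)) ^ 4 + (snd p) ^ 2)"

definition kor_dist :: "'n::finite heis \<Rightarrow> 'n heis \<Rightarrow> real" where
  "kor_dist x y = kor_norm (heis_mult (heis_inv y) x)"

definition kor_ball :: "'n::finite heis \<Rightarrow> real \<Rightarrow> 'n heis set" where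
  "kor_ball a r = {x. kor_norm (heis_mult (heis_inv a) x) < r}"

end

theory Submission
  imports Defs "HOL-Probability.Probability_Measure"
begin

text \<open>
  The points \<open>(u e\<^sub>1, v)\<close> with \<open>u, v\<close> real form an abelian subgroup \<open>P\<close>, a copy of the plane, and on
  every coset \<open>q P\<close> the fourth power of the distance is \<open>(\<Delta>u)^4 + (\<Delta>v)^2\<close>, so it is enough to find the distance
  inside a single coset. Averaging over right translations transfers positive upper density to the
  cosets: with \<open>d(S)\<close> the supremum over all cosets of the density in a box \<open>S \<times> S^2\<close>, the infimum \<open>D\<close>
  of \<open>d\<close> is positive. Choose \<open>s\<close> with \<open>d(s) < D + \<epsilon>\<close>.

  Rescale by \<open>R\<close> and let \<open>\<gamma>\<close> parametrise an arc of \<open>u^4 + v^2 = 1\<close>. The law of \<open>\<gamma>(y) - \<gamma>(x)\<close> is absolutely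
  continuous because the arc is strictly concave, so it is almost invariant under small
  translations; averaging over a box of scale \<open>s/R\<close>, it gives every rescaled section mass at most
  \<open>U = D + 2\<epsilon>\<close> once \<open>R\<close> is large. If the section \<open>E\<close>, cut down to a large box in which its density
  exceeds \<open>D - \<epsilon>\<close>, contains no pair \<open>p, p + \<gamma>(x)\<close>, then \<open>T(p) = |{x. p + \<gamma>(x) \<in> E}|\<close> vanishes on \<open>E\<close>, has
  integral \<open>|E|\<close>, and the integral of its square is at most \<open>U |E|\<close>. By Cauchy-Schwarz \<open>|E|\<close> is at most
  \<open>U\<close> times the measure of the complement of \<open>E\<close> in a slightly larger box, hence
  \<open>D \<le> D (1 - D)\<close> up to errors that can be made arbitrarily small, a contradiction.
\<close>

section \<open>Lebesgue measure on products\<close>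

text \<open>By Fubini: for fixed first coordinate the second is merely translated, and then the
  first is translated. Heisenberg translations on either side are maps of this kind, which is what
  makes Lebesgue measure bi-invariant.\<close>

lemma distr_shear_lborel:
  fixes w :: "'a::euclidean_space" and g :: "'a \<Rightarrow> 'b::euclidean_space"
  assumes [measurable]: "g \<in> borel_measurable borel"
  shows "distr lborel borel (\<lambda>p. (fst p + w, snd p + g (fst p))) = lborel"
proof (rule measure_eqI)
  fix X :: "('a \<times> 'b) set"
  assume "X \<in> sets (distr lborel borel (\<lambda>p. (fst p + w, snd p + g (fst p))))"
  then have X[measurable]: "X \<in> sets borel" by simp
  have m: "(\<lambda>p::'a \<times> 'b. (fst p + w, snd p + g (fst p))) \<in> borel_measurable borel"
    unfolding borel_prod[symmetric] by measurable
  have mi: "(\<lambda>p. indicator X (fst p + w, snd p + g (fst p)) :: ennreal) \<in> borel_measurable borel"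
    by (rule measurable_compose[OF m borel_measurable_indicator]) (rule X)
  have "emeasure (distr lborel borel (\<lambda>p. (fst p + w, snd p + g (fst p)))) X
     = (\<integral>\<^sup>+p. indicator X (fst p + w, snd p + g (fst p)) \<partial>(lborel::('a \<times> 'b) measure))"
    using nn_integral_distr[of "\<lambda>p. (fst p + w, snd p + g (fst p))" lborel borel "indicator X"] m mi
    by simp
  also have "\<dots> = (\<integral>\<^sup>+z. \<integral>\<^sup>+t. indicator X (z + w, t + g z) \<partial>lborel \<partial>lborel)"
    using mi
    by (subst lborel_prod[symmetric], subst lborel.nn_integral_fst[symmetric]) (auto simp: lborel_prod)
  also have "\<dots> = (\<integral>\<^sup>+z. \<integral>\<^sup>+t. indicator X (z + w, t) \<partial>lborel \<partial>lborel)"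
  proof (rule nn_integral_cong)
    fix z
    have "(\<integral>\<^sup>+t. indicator X (z + w, t) \<partial>lborel)
        = (\<integral>\<^sup>+t. indicator X (z + w, t) \<partial>distr lborel borel ((+) (g z)))"
      by (simp add: lborel_distr_plus)
    then show "(\<integral>\<^sup>+t. indicator X (z + w, t + g z) \<partial>lborel) = (\<integral>\<^sup>+t. indicator X (z + w, t) \<partial>lborel)"
      by (simp add: nn_integral_distr add.commute)
  qed
  also have "\<dots> = (\<integral>\<^sup>+z. \<integral>\<^sup>+t. indicator X (z, t) \<partial>lborel \<partial>distr lborel borel ((+) w))"
    by (subst nn_integral_distr) (auto simp: add.commute lborel_prod)
  also have "\<dots> = (\<integral>\<^sup>+z. \<integral>\<^sup>+t. indicator X (z, t) \<partial>lborel \<partial>lborel)"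
    by (simp add: lborel_distr_plus)
  also have "\<dots> = emeasure lborel X"
    by (subst lborel.nn_integral_fst) (auto simp: lborel_prod)
  finally show "emeasure (distr lborel borel (\<lambda>p. (fst p + w, snd p + g (fst p)))) X = emeasure lborel X" .
qed simp

text \<open>Fubini with one affine substitution per coordinate. It is applied to the parabolic
  dilations, where the second factor is the square of the first.\<close>

lemma emeasure_lborel_scale_prod:
  fixes X :: "(real \<times> real) set"
  assumes [measurable]: "X \<in> sets borel" and "\<alpha> > 0" "\<beta> > 0"
  shows "emeasure lborel X = ennreal (\<alpha> * \<beta>) * emeasure lborel {p. (\<alpha> * fst p, \<beta> * snd p) \<in> X}"
proof -
  have "(\<lambda>p::real \<times> real. (\<alpha> * fst p, \<beta> * snd p)) \<in> borel_measurable borel"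
    unfolding borel_prod[symmetric] by measurable
  from measurable_sets[OF this assms(1)]
  have m: "{p. (\<alpha> * fst p, \<beta> * snd p) \<in> X} \<in> sets borel" by (simp add: vimage_def)
  have "emeasure lborel X = (\<integral>\<^sup>+z. \<integral>\<^sup>+t. indicator X (z, t) \<partial>lborel \<partial>lborel)"
    by (subst lborel.nn_integral_fst) (auto simp: lborel_prod)
  also have "\<dots> = (\<integral>\<^sup>+z. ennreal \<beta> * (\<integral>\<^sup>+t. indicator X (z, \<beta> * t) \<partial>lborel) \<partial>lborel)"
    using nn_integral_real_affine[where c=\<beta> and t=0 and f="\<lambda>t. indicator X (_, t)"] assms
    by simp
  also have "\<dots> = ennreal \<alpha> * (\<integral>\<^sup>+z. ennreal \<beta> * (\<integral>\<^sup>+t. indicator X (\<alpha> * z, \<beta> * t) \<partial>lborel) \<partial>lborel)"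
    using assms by (subst nn_integral_real_affine[where c=\<alpha> and t=0]) (auto simp: lborel_prod)
  also have "\<dots> = ennreal (\<alpha> * \<beta>) * (\<integral>\<^sup>+z. (\<integral>\<^sup>+t. indicator X (\<alpha> * z, \<beta> * t) \<partial>lborel) \<partial>lborel)"
    using assms by (subst nn_integral_cmult) (auto simp: lborel_prod ennreal_mult mult.assoc)
  also have "(\<integral>\<^sup>+z. (\<integral>\<^sup>+t. indicator X (\<alpha> * z, \<beta> * t) \<partial>lborel) \<partial>lborel)
     = (\<integral>\<^sup>+z. \<integral>\<^sup>+t. indicator {p. (\<alpha> * fst p, \<beta> * snd p) \<in> X} (z, t) \<partial>lborel \<partial>lborel)"
    by (simp add: indicator_def)
  also have "\<dots> = (\<integral>\<^sup>+p. indicator {p. (\<alpha> * fst p, \<beta> * snd p) \<in> X} p \<partial>lborel)"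
    using m by (subst lborel.nn_integral_fst) (auto simp: lborel_prod)
  also have "\<dots> = emeasure lborel {p. (\<alpha> * fst p, \<beta> * snd p) \<in> X}"
    using m by (intro nn_integral_indicator) simp
  finally show ?thesis .
qed

section \<open>Continuity of translation in the mean\<close>

lemma integrable_lborel_translate:
  fixes f :: "'a::euclidean_space \<Rightarrow> 'b::{banach, second_countable_topology}"
  assumes "integrable lborel f"
  shows "integrable lborel (\<lambda>x. f (x + b))"
proof -
  have "integrable (distr lborel borel ((+) b)) f"
    using assms by (simp add: lborel_distr_plus)
  then show ?thesis
    using borel_measurable_integrable[OF assms] by (subst (asm) integrable_distr_eq) (auto simp: add.commute)
qed

lemma integral_lborel_translate:
  fixes f :: "'a::euclidean_space \<Rightarrow> 'b::{banach, second_countable_topology}"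
  assumes "f \<in> borel_measurable borel"
  shows "(\<integral>x. f (x + b) \<partial>lborel) = (\<integral>x. f x \<partial>lborel)"
proof -
  have "(\<integral>x. f x \<partial>lborel) = (\<integral>x. f x \<partial>distr lborel borel ((+) b))"
    by (simp add: lborel_distr_plus)
  also have "\<dots> = (\<integral>x. f (b + x) \<partial>lborel)"
    using assms by (subst integral_distr) auto
  finally show ?thesis by (simp add: add.commute)
qed

text \<open>Phrased along sequences so that dominated convergence applies directly.\<close>

definition L1_translation_continuous :: "('a::euclidean_space \<Rightarrow> 'b::{banach, second_countable_topology}) \<Rightarrow> bool" where
  "L1_translation_continuous f \<longleftrightarrow>
     (\<forall>b. b \<longlonglongrightarrow> 0 \<longrightarrow> (\<lambda>n. \<integral>x. norm (f (x + b n) - f x) \<partial>lborel) \<longlonglongrightarrow> 0)"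

text \<open>The property survives L1 approximation: in a three-term triangle inequality the
  translated error \<open>f (x + b n) - g (x + b n)\<close> has the same L1 norm as
  \<open>f - g\<close>, whatever the shift.\<close>

lemma L1_translation_continuous_approx:
  fixes f :: "'a::euclidean_space \<Rightarrow> 'b::{banach, second_countable_topology}"
  assumes f: "integrable lborel f"
    and ap: "\<And>e. e > 0 \<Longrightarrow> \<exists>g. integrable lborel g \<and> L1_translation_continuous g \<and> (\<integral>x. norm (f x - g x) \<partial>lborel) \<le> e"
  shows "L1_translation_continuous f"
  unfolding L1_translation_continuous_def
proof (intro allI impI LIMSEQ_I)
  fix b :: "nat \<Rightarrow> 'a" and r :: real assume b: "b \<longlonglongrightarrow> 0" and r: "0 < r"
  obtain g where g: "integrable lborel g" "L1_translation_continuous g" "(\<integral>x. norm (f x - g x) \<partial>lborel) \<le> r/4"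
    using ap[of "r/4"] r by auto
  then obtain N where N: "\<And>n. n \<ge> N \<Longrightarrow> (\<integral>x. norm (g (x + b n) - g x) \<partial>lborel) < r/4"
    using b r LIMSEQ_D[of "\<lambda>n. \<integral>x. norm (g (x + b n) - g x) \<partial>lborel" 0 "r/4"]
    unfolding L1_translation_continuous_def by fastforce
  show "\<exists>N. \<forall>n\<ge>N. norm ((\<integral>x. norm (f (x + b n) - f x) \<partial>lborel) - 0) < r"
  proof (intro exI allI impI)
    fix n assume n: "n \<ge> N"
    note it = integrable_lborel_translate[of _ "b n"]
    have [measurable]: "f \<in> borel_measurable borel" "g \<in> borel_measurable borel"
      using f g(1) borel_measurable_integrable by fastforce+
    have "(\<integral>x. norm (f (x + b n) - f x) \<partial>lborel)
       \<le> (\<integral>x. norm (f (x + b n) - g (x + b n)) + norm (g (x + b n) - g x) + norm (f x - g x) \<partial>lborel)"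
    proof (rule integral_mono)
      fix x
      show "norm (f (x + b n) - f x)
        \<le> norm (f (x + b n) - g (x + b n)) + norm (g (x + b n) - g x) + norm (f x - g x)"
        using norm_triangle_ineq[of "f (x + b n) - g (x + b n) + (g (x + b n) - g x)" "g x - f x"]
          norm_triangle_ineq[of "f (x + b n) - g (x + b n)" "g (x + b n) - g x"]
          norm_minus_commute[of "g x" "f x"] by simp
    qed (use f g(1) it[OF f] it[OF g(1)] in simp_all)
    also have "\<dots> = (\<integral>x. norm (f (x + b n) - g (x + b n)) \<partial>lborel)
        + (\<integral>x. norm (g (x + b n) - g x) \<partial>lborel) + (\<integral>x. norm (f x - g x) \<partial>lborel)"
      using f g(1) it[OF f] it[OF g(1)] by simp
    also have "(\<integral>x. norm (f (x + b n) - g (x + b n)) \<partial>lborel) = (\<integral>x. norm (f x - g x) \<partial>lborel)"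
      by (rule integral_lborel_translate[where f="\<lambda>x. norm (f x - g x)"]) measurable
    finally show "norm ((\<integral>x. norm (f (x + b n) - f x) \<partial>lborel) - 0) < r"
      using g(3) N[OF n] r by simp
  qed
qed

text \<open>The L1 distance to a translate is determined by the overlap of \<open>U\<close> with
  that translate. At a point of \<open>U\<close>, openness keeps \<open>x + b n\<close> in
  \<open>U\<close> eventually; other points contribute nothing to the overlap, so the boundary
  causes no trouble.\<close>

lemma L1_translation_continuous_open:
  fixes U :: "'a::euclidean_space set" and c :: "'b::{banach, second_countable_topology}"
  assumes U: "open U" "emeasure lborel U < \<infinity>"
  shows "L1_translation_continuous (\<lambda>x. indicator U x *\<^sub>R c)"
  unfolding L1_translation_continuous_def
proof (intro allI impI)
  fix b :: "nat \<Rightarrow> 'a" assume b: "b \<longlonglongrightarrow> 0"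
  let ?i = "indicator U :: 'a \<Rightarrow> real"
  have [measurable]: "U \<in> sets borel" using U by simp
  have iU: "integrable lborel ?i" using U by (intro integrable_real_indicator) auto
  note itU = integrable_lborel_translate[OF iU]
  have i2: "integrable lborel (\<lambda>x. ?i x * ?i (x + b n))" for n
    by (rule Bochner_Integration.integrable_bound[OF iU]) (auto simp: indicator_def)
  have conv: "(\<lambda>n. \<integral>x. ?i x * ?i (x + b n) \<partial>lborel) \<longlonglongrightarrow> (\<integral>x. ?i x \<partial>lborel)"
  proof (rule integral_dominated_convergence[where w="?i"])
    show "AE x in lborel. (\<lambda>n. ?i x * ?i (x + b n)) \<longlonglongrightarrow> ?i x"
    proof (rule AE_I2)
      fix x
      show "(\<lambda>n. ?i x * ?i (x + b n)) \<longlonglongrightarrow> ?i x"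
      proof (cases "x \<in> U")
        case True
        have "(\<lambda>n. x + b n) \<longlonglongrightarrow> x + 0" by (intro tendsto_intros b)
        then have "\<forall>\<^sub>F n in sequentially. x + b n \<in> U"
          using topological_tendstoD[OF _ U(1)] True by simp
        then show ?thesis
          using True by (intro tendsto_eventually) (auto elim: eventually_mono)
      qed simp
    qed
  qed (use iU in \<open>auto simp: indicator_def\<close>)
  have "(\<integral>x. norm (?i (x + b n) *\<^sub>R c - ?i x *\<^sub>R c) \<partial>lborel)
      = norm c * (2 * (\<integral>x. ?i x \<partial>lborel) - 2 * (\<integral>x. ?i x * ?i (x + b n) \<partial>lborel))" for n
  proof -
    have "(\<integral>x. norm (?i (x + b n) *\<^sub>R c - ?i x *\<^sub>R c) \<partial>lborel)
       = (\<integral>x. norm c * (?i (x + b n) + ?i x - 2 * (?i x * ?i (x + b n))) \<partial>lborel)"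
      by (intro Bochner_Integration.integral_cong) (auto simp: indicator_def)
    also have "\<dots> = norm c * ((\<integral>x. ?i (x + b n) \<partial>lborel) + (\<integral>x. ?i x \<partial>lborel)
        - 2 * (\<integral>x. ?i x * ?i (x + b n) \<partial>lborel))"
      using iU itU i2 by simp
    also have "(\<integral>x. ?i (x + b n) \<partial>lborel) = (\<integral>x. ?i x \<partial>lborel)"
      by (rule integral_lborel_translate) measurable
    finally show ?thesis by simp
  qed
  then show "(\<lambda>n. \<integral>x. norm (?i (x + b n) *\<^sub>R c - ?i x *\<^sub>R c) \<partial>lborel) \<longlonglongrightarrow> 0"
    using tendsto_mult[OF tendsto_const[of "norm c"]
        tendsto_diff[OF tendsto_const[of "2 * (\<integral>x. ?i x \<partial>lborel)"] tendsto_mult[OF tendsto_const[of 2] conv]]]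
    by simp
qed

text \<open>Induction over integrable functions: outer regularity reduces indicators to open sets,
  sums follow from the triangle inequality, and limits from L1 approximation.\<close>

lemma L1_translation_continuous_integrable:
  fixes f :: "'a::euclidean_space \<Rightarrow> 'b::{banach, second_countable_topology}"
  assumes "integrable lborel f"
  shows "L1_translation_continuous f"
  using assms
proof (induction rule: integrable_induct)
  case (base A c)
  then have [measurable]: "A \<in> sets borel" by simp
  have iA: "integrable lborel (indicator A :: _ \<Rightarrow> real)"
    using base by (intro integrable_real_indicator) auto
  show ?case
  proof (rule L1_translation_continuous_approx)
    show "integrable lborel (\<lambda>x. indicator A x *\<^sub>R c)" using iA by auto
    fix e :: real assume e: "e > 0"
    \<comment> \<open>The summand 1 in the denominator covers \<open>c = 0\<close>.\<close>
    define d where "d = e / (norm c + 1)"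
    have d: "d > 0" using e by (simp add: d_def add_nonneg_pos)
    obtain U where U: "open U" "A \<subseteq> U" "emeasure lborel (U - A) < d"
      using outer_regular_lborel[of A d] d by auto
    have [measurable]: "U \<in> sets borel" using U by simp
    have "emeasure lborel U \<le> emeasure lborel A + emeasure lborel (U - A)"
      using emeasure_subadditive[of A lborel "U - A"] U(2) by (simp add: Un_absorb1)
    also have "\<dots> < \<infinity>"
      using base U by (simp add: less_top order_less_trans[OF U(3) ennreal_less_top])
    finally have fU: "emeasure lborel U < \<infinity>" .
    have iU: "integrable lborel (indicator U :: _ \<Rightarrow> real)"
      using fU by (intro integrable_real_indicator) auto
    have "(\<integral>x. norm (indicator A x *\<^sub>R c - indicator U x *\<^sub>R c) \<partial>lborel) = (\<integral>x. norm c * indicator (U - A) x \<partial>lborel)"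
      using U(2) by (intro Bochner_Integration.integral_cong) (auto simp: indicator_def)
    also have "\<dots> = norm c * measure lborel (U - A)" by simp
    also have "\<dots> \<le> norm c * d"
    proof (intro mult_left_mono)
      show "measure lborel (U - A) \<le> d"
        using U(3) d by (simp add: measure_def enn2real_leI)
    qed simp
    also have "\<dots> = e * (norm c / (norm c + 1))" by (simp add: d_def)
    also have "\<dots> \<le> e * 1"
      using e by (intro mult_left_mono) (simp_all add: divide_le_eq add_nonneg_pos)
    also have "\<dots> = e" by simp
    finally show "\<exists>g. integrable lborel g \<and> L1_translation_continuous g
        \<and> (\<integral>x. norm (indicator A x *\<^sub>R c - g x) \<partial>lborel) \<le> e"
      using iU L1_translation_continuous_open[OF U(1) fU]
      by (intro exI[of _ "\<lambda>x. indicator U x *\<^sub>R c"]) auto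
  qed
next
  case (add f g)
  have [measurable]: "f \<in> borel_measurable borel" "g \<in> borel_measurable borel"
    using add.hyps borel_measurable_integrable by fastforce+
  note it = integrable_lborel_translate[OF add.hyps(1)] integrable_lborel_translate[OF add.hyps(2)]
  show ?case
    unfolding L1_translation_continuous_def
  proof (intro allI impI)
    fix b :: "nat \<Rightarrow> 'a" assume b: "b \<longlonglongrightarrow> 0"
    show "(\<lambda>n. \<integral>x. norm (f (x + b n) + g (x + b n) - (f x + g x)) \<partial>lborel) \<longlonglongrightarrow> 0"
    proof (rule tendsto_sandwich[where f="\<lambda>_. 0", OF always_eventually always_eventually])
      show "(\<lambda>n. (\<integral>x. norm (f (x + b n) - f x) \<partial>lborel) + (\<integral>x. norm (g (x + b n) - g x) \<partial>lborel)) \<longlonglongrightarrow> 0"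
        using add.IH b unfolding L1_translation_continuous_def by (auto intro!: tendsto_add_zero)
      show "\<forall>n. (\<integral>x. norm (f (x + b n) + g (x + b n) - (f x + g x)) \<partial>lborel)
         \<le> (\<integral>x. norm (f (x + b n) - f x) \<partial>lborel) + (\<integral>x. norm (g (x + b n) - g x) \<partial>lborel)"
      proof
        fix n
        have "(\<integral>x. norm (f (x + b n) + g (x + b n) - (f x + g x)) \<partial>lborel)
         \<le> (\<integral>x. norm (f (x + b n) - f x) + norm (g (x + b n) - g x) \<partial>lborel)"
        proof (rule integral_mono)
          show "norm (f (x + b n) + g (x + b n) - (f x + g x))
              \<le> norm (f (x + b n) - f x) + norm (g (x + b n) - g x)" for x
            by (metis add_diff_add norm_triangle_ineq)
        qed (use add.hyps it in simp_all)
        then show "(\<integral>x. norm (f (x + b n) + g (x + b n) - (f x + g x)) \<partial>lborel)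
         \<le> (\<integral>x. norm (f (x + b n) - f x) \<partial>lborel) + (\<integral>x. norm (g (x + b n) - g x) \<partial>lborel)"
          using add.hyps it by simp
      qed
    qed auto
  qed
next
  case (lim f s)
  have [measurable]: "f \<in> borel_measurable borel" "s i \<in> borel_measurable borel" for i
    using lim.hyps(1,4) borel_measurable_integrable by fastforce+
  show ?case
  proof (rule L1_translation_continuous_approx[OF lim.hyps(4)])
    fix e :: real assume e: "e > 0"
    \<comment> \<open>The induction supplies \<open>norm (s i x) \<le> 2 * norm (f x)\<close>,
      whence the dominating function \<open>3 * norm (f x)\<close>.\<close>
    have "(\<lambda>i. \<integral>x. norm (f x - s i x) \<partial>lborel) \<longlonglongrightarrow> (\<integral>x. 0 \<partial>(lborel :: 'a measure))"
    proof (rule integral_dominated_convergence[where w="\<lambda>x. 3 * norm (f x)"])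
      show "AE x in lborel. (\<lambda>i. norm (f x - s i x)) \<longlonglongrightarrow> 0"
      proof (rule AE_I2)
        fix x
        have "(\<lambda>i. f x - s i x) \<longlonglongrightarrow> f x - f x"
          using lim.hyps(2) by (intro tendsto_intros) auto
        then show "(\<lambda>i. norm (f x - s i x)) \<longlonglongrightarrow> 0" by (simp add: tendsto_norm_zero)
      qed
      show "AE x in lborel. norm (norm (f x - s i x)) \<le> 3 * norm (f x)" for i
      proof (rule AE_I2)
        fix x
        show "norm (norm (f x - s i x)) \<le> 3 * norm (f x)"
          using norm_triangle_ineq4[of "f x" "s i x"] lim.hyps(3)[of x i] by simp
      qed
    qed (use lim.hyps(4) in auto)
    then have "(\<lambda>i. \<integral>x. norm (f x - s i x) \<partial>lborel) \<longlonglongrightarrow> 0" by simp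
    from LIMSEQ_D[OF this e] obtain i where "norm ((\<integral>x. norm (f x - s i x) \<partial>lborel) - 0) < e" by blast
    then show "\<exists>g. integrable lborel g \<and> L1_translation_continuous g \<and> (\<integral>x. norm (f x - g x) \<partial>lborel) \<le> e"
      using lim.hyps(1) lim.IH by (intro exI[of _ "s i"]) auto
  qed
qed

section \<open>Translation continuity of measures and avoided shifts\<close>

lemma translate_in_sets_borel:
  fixes E :: "'a::euclidean_space set"
  assumes "E \<in> sets borel"
  shows "{x. x + b \<in> E} \<in> sets borel" "{x. b + x \<in> E} \<in> sets borel"
  using measurable_sets[of "\<lambda>x. x + b" borel borel E] measurable_sets[of "\<lambda>x. b + x" borel borel E] assms
  by (simp_all add: vimage_def)

text \<open>With \<open>f\<close> the Radon-Nikodym density, the loss of mass under a shift is at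
  most the L1 distance of \<open>f\<close> from its translate, for every \<open>E\<close> at once.
  This uniformity matters: \<delta> is fixed before the set to which the bound is applied is
  known.\<close>

lemma absolutely_continuous_translate:
  fixes N :: "'a::euclidean_space measure"
  assumes N: "finite_measure N" "sets N = sets borel" "absolutely_continuous lborel N"
    and e: "e > 0"
  shows "\<exists>\<delta>>0. \<forall>b. norm b < \<delta> \<longrightarrow>
    (\<forall>E\<in>sets borel. measure N E \<le> measure N {x. x + b \<in> E} + e)"
proof -
  interpret N: finite_measure N by fact
  obtain k where k[measurable]: "k \<in> borel_measurable borel" and Nk: "density lborel k = N"
    using sigma_finite_measure.Radon_Nikodym[OF sigma_finite_lborel N(3)] N(2) by auto
  have "(\<integral>\<^sup>+x. k x \<partial>lborel) = emeasure N (space N)"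
    unfolding Nk[symmetric] by (subst emeasure_density) auto
  then have kfin: "(\<integral>\<^sup>+x. k x \<partial>lborel) \<noteq> \<infinity>"
    using N.emeasure_finite by simp
  \<comment> \<open>The density \<open>k\<close> has extended values but finite integral, so it
    agrees almost everywhere with a real-valued one.\<close>
  define f where "f x = enn2real (k x)" for x
  have f[measurable]: "f \<in> borel_measurable borel" and f0: "f x \<ge> 0" for x
    unfolding f_def by simp_all
  have AEk: "AE x in lborel. k x = ennreal (f x)"
    using nn_integral_PInf_AE[OF _ kfin] by (auto simp: f_def less_top)
  have Nf: "N = density lborel (\<lambda>x. ennreal (f x))"
    unfolding Nk[symmetric] using AEk by (intro density_cong) auto
  have fi: "integrable lborel f"
  proof (rule integrableI_nonneg)
    have "(\<integral>\<^sup>+x. ennreal (f x) \<partial>lborel) = (\<integral>\<^sup>+x. k x \<partial>lborel)"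
      using AEk by (intro nn_integral_cong_AE) auto
    then show "(\<integral>\<^sup>+x. ennreal (f x) \<partial>lborel) < \<infinity>" using kfin by (simp add: less_top)
  qed (use f0 in auto)
  have meas: "measure N E = (\<integral>x. f x * indicator E x \<partial>lborel)" if [measurable]: "E \<in> sets borel" for E
  proof -
    have "measure N E = (\<integral>x. indicator E x \<partial>N)" using N(2) sets_eq_imp_space_eq[OF N(2)] that by simp
    also have "\<dots> = (\<integral>x. f x * indicator E x \<partial>lborel)"
      unfolding Nf by (subst integral_density) (auto simp: f0)
    finally show ?thesis .
  qed
  \<comment> \<open>From sequences to \<delta>: failure at every \<open>1 / real (Suc n)\<close>
    would give shifts tending to 0 that violate L1 continuity.\<close>
  obtain \<delta> where \<delta>: "\<delta> > 0" "\<And>b. norm b < \<delta> \<Longrightarrow> (\<integral>x. norm (f (x + b) - f x) \<partial>lborel) < e"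
  proof (rule ccontr)
    assume "\<not> thesis"
    then have "\<forall>n. \<exists>b. norm b < 1 / real (Suc n) \<and> \<not> (\<integral>x. norm (f (x + b) - f x) \<partial>lborel) < e"
      using that by (metis of_nat_0_less_iff zero_less_Suc zero_less_divide_1_iff)
    then obtain b where b: "\<And>n. norm (b n) < 1 / real (Suc n)"
       "\<And>n. \<not> (\<integral>x. norm (f (x + b n) - f x) \<partial>lborel) < e" by metis
    have "b \<longlonglongrightarrow> 0"
      using b(1) by (intro LIMSEQ_norm_0)
    then have "(\<lambda>n. \<integral>x. norm (f (x + b n) - f x) \<partial>lborel) \<longlonglongrightarrow> 0"
      using L1_translation_continuous_integrable[OF fi] by (simp add: L1_translation_continuous_def)
    from order_tendstoD(2)[OF this e] show False
      using b(2) by (auto simp: eventually_sequentially)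
  qed
  show ?thesis
  proof (intro exI[of _ \<delta>] conjI allI impI ballI \<delta>)
    fix b :: 'a and E :: "'a set" assume b: "norm b < \<delta>" and E[measurable]: "E \<in> sets borel"
    note fi' = integrable_lborel_translate[OF fi]
    have "measure N {x. x + b \<in> E} = (\<integral>x. f x * indicator {x. x + b \<in> E} x \<partial>lborel)"
      by (rule meas[OF translate_in_sets_borel(1)[OF E]])
    also have "\<dots> = (\<integral>x. f ((x + b) - b) * indicator E (x + b) \<partial>lborel)"
      by (simp add: indicator_def)
    also have "\<dots> = (\<integral>x. f (x - b) * indicator E x \<partial>lborel)"
      by (rule integral_lborel_translate[where f="\<lambda>x. f (x - b) * indicator E x"]) measurable
    finally have 1: "measure N {x. x + b \<in> E} = (\<integral>x. f (x - b) * indicator E x \<partial>lborel)" .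
    have i1: "integrable lborel (\<lambda>x. f x * indicator E x)"
      using integrable_mult_indicator[OF _ fi, of E] by (simp add: mult.commute)
    have i2: "integrable lborel (\<lambda>x. f (x - b) * indicator E x)"
      using integrable_mult_indicator[OF _ fi'[of "-b"], of E] by (simp add: mult.commute)
    have "measure N E - measure N {x. x + b \<in> E} = (\<integral>x. f x * indicator E x - f (x - b) * indicator E x \<partial>lborel)"
      unfolding 1 meas[OF E] using i1 i2 by simp
    also have "\<dots> \<le> (\<integral>x. norm (f (x + - b) - f x) \<partial>lborel)"
      using i1 i2 fi fi'[of "-b"] by (intro integral_mono) (auto simp: indicator_def)
    also have "\<dots> < e" using \<delta>(2)[of "-b"] b by simp
    finally show "measure N E \<le> measure N {x. x + b \<in> E} + e" by simp
  qed
qed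

section \<open>Second-moment bound for sets that avoid random shifts\<close>

lemma nn_integral_lborel_translate:
  fixes f :: "'a::euclidean_space \<Rightarrow> ennreal"
  assumes "f \<in> borel_measurable borel"
  shows "(\<integral>\<^sup>+x. f (x + b) \<partial>lborel) = (\<integral>\<^sup>+x. f x \<partial>lborel)"
proof -
  have "(\<integral>\<^sup>+x. f x \<partial>lborel) = (\<integral>\<^sup>+x. f x \<partial>distr lborel borel ((+) b))"
    by (simp add: lborel_distr_plus)
  also have "\<dots> = (\<integral>\<^sup>+x. f (b + x) \<partial>lborel)"
    using assms by (subst nn_integral_distr) auto
  finally show ?thesis by (simp add: add.commute)
qed

text \<open>Read \<open>\<gamma>\<close> as a random shift and \<open>T p\<close> as the probability
  that it carries \<open>p\<close> into \<open>E\<close>. By \<open>avoid\<close> and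
  \<open>inC\<close>, \<open>T\<close> lives on \<open>C - E\<close>; its integral is the measure of
  \<open>E\<close>, and \<open>sparse\<close> bounds its second moment. A function with small second
  moment cannot be concentrated on too small a set.\<close>

lemma measure_avoiding_shifts:
  fixes \<gamma> :: "'c \<Rightarrow> 'a::euclidean_space"
  assumes "prob_space M" and \<gamma>[measurable]: "\<gamma> \<in> M \<rightarrow>\<^sub>M borel"
    and E[measurable]: "E \<in> sets borel" and C[measurable]: "C \<in> sets borel"
    and fin: "emeasure lborel C < \<infinity>" and EC: "E \<subseteq> C" and U: "U > 0"
    and sparse: "\<And>p. p \<in> E \<Longrightarrow>
      measure (distr (M \<Otimes>\<^sub>M M) borel (\<lambda>z. \<gamma> (snd z) - \<gamma> (fst z))) {w. p + w \<in> E} \<le> U"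
    and avoid: "\<And>p x. p \<in> E \<Longrightarrow> x \<in> space M \<Longrightarrow> p + \<gamma> x \<notin> E"
    and inC: "\<And>p x. x \<in> space M \<Longrightarrow> p + \<gamma> x \<in> E \<Longrightarrow> p \<in> C"
  shows "measure lborel E \<le> U * (measure lborel C - measure lborel E)"
proof -
  interpret M: prob_space M by fact
  interpret MM: pair_prob_space M M ..
  let ?\<nu> = "distr (M \<Otimes>\<^sub>M M) borel (\<lambda>z. \<gamma> (snd z) - \<gamma> (fst z))"
  interpret \<nu>: prob_space ?\<nu> by (rule MM.prob_space_distr) measurable
  interpret L: pair_sigma_finite "lborel :: 'a measure" "M \<Otimes>\<^sub>M M" ..
  interpret L1: pair_sigma_finite "lborel :: 'a measure" M ..
  let ?i = "indicator E :: 'a \<Rightarrow> ennreal"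
  define T where "T p = (\<integral>\<^sup>+x. ?i (p + \<gamma> x) \<partial>M)" for p
  have T[measurable]: "T \<in> borel_measurable borel" unfolding T_def by measurable
  have Eset: "{x \<in> space M. p + \<gamma> x \<in> E} \<in> sets M" for p by measurable
  have T_eq: "T p = ennreal (measure M {x \<in> space M. p + \<gamma> x \<in> E})" for p
  proof -
    have "T p = (\<integral>\<^sup>+x. indicator {x \<in> space M. p + \<gamma> x \<in> E} x \<partial>M)"
      unfolding T_def by (intro nn_integral_cong) (auto simp: indicator_def)
    then show ?thesis using Eset by (simp add: M.emeasure_eq_measure)
  qed
  have finE: "emeasure lborel E < \<infinity>"
    using emeasure_mono[OF EC, of lborel] fin by (auto intro: le_less_trans)
  have I1: "(\<integral>\<^sup>+p. T p \<partial>lborel) = emeasure lborel E"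
  proof -
    have "(\<integral>\<^sup>+p. T p \<partial>lborel) = (\<integral>\<^sup>+x. \<integral>\<^sup>+p. ?i (p + \<gamma> x) \<partial>lborel \<partial>M)"
      unfolding T_def by (subst L1.Fubini') simp_all
    also have "\<dots> = (\<integral>\<^sup>+x. emeasure lborel E \<partial>M)"
      by (subst nn_integral_lborel_translate) simp_all
    also have "\<dots> = emeasure lborel E" by (simp add: M.emeasure_space_1)
    finally show ?thesis .
  qed
  have I2: "(\<integral>\<^sup>+p. T p * T p \<partial>lborel) \<le> ennreal U * emeasure lborel E"
  proof -
    \<comment> \<open>The square becomes an integral over two independent shifts.\<close>
    have "T p * T p = (\<integral>\<^sup>+z. ?i (p + \<gamma> (fst z)) * ?i (p + \<gamma> (snd z)) \<partial>(M \<Otimes>\<^sub>M M))" for p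
    proof -
      have "(\<integral>\<^sup>+z. ?i (p + \<gamma> (fst z)) * ?i (p + \<gamma> (snd z)) \<partial>(M \<Otimes>\<^sub>M M))
        = (\<integral>\<^sup>+x. \<integral>\<^sup>+y. ?i (p + \<gamma> x) * ?i (p + \<gamma> y) \<partial>M \<partial>M)"
        by (subst M.nn_integral_fst[symmetric]) simp_all
      also have "\<dots> = T p * T p"
        unfolding T_def by (simp add: nn_integral_cmult nn_integral_multc)
      finally show ?thesis ..
    qed
    then have "(\<integral>\<^sup>+p. T p * T p \<partial>lborel)
       = (\<integral>\<^sup>+z. \<integral>\<^sup>+p. ?i (p + \<gamma> (fst z)) * ?i (p + \<gamma> (snd z)) \<partial>lborel \<partial>(M \<Otimes>\<^sub>M M))"
      by simp (subst L.Fubini', simp_all)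
    \<comment> \<open>Recentring at \<open>p + \<gamma> (fst z)\<close> leaves only the difference
      of the two shifts, whose law is \<open>?\<nu>\<close>.\<close>
    also have "\<dots> = (\<integral>\<^sup>+z. \<integral>\<^sup>+p. ?i p * ?i (p + (\<gamma> (snd z) - \<gamma> (fst z))) \<partial>lborel \<partial>(M \<Otimes>\<^sub>M M))"
    proof (rule nn_integral_cong)
      fix z
      have "(\<integral>\<^sup>+p. ?i (p + \<gamma> (fst z)) * ?i ((p + \<gamma> (fst z)) + (\<gamma> (snd z) - \<gamma> (fst z))) \<partial>lborel)
         = (\<integral>\<^sup>+p. ?i p * ?i (p + (\<gamma> (snd z) - \<gamma> (fst z))) \<partial>lborel)"
        by (rule nn_integral_lborel_translate[where f="\<lambda>p. ?i p * ?i (p + (\<gamma> (snd z) - \<gamma> (fst z)))"]) measurable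
      then show "(\<integral>\<^sup>+p. ?i (p + \<gamma> (fst z)) * ?i (p + \<gamma> (snd z)) \<partial>lborel)
         = (\<integral>\<^sup>+p. ?i p * ?i (p + (\<gamma> (snd z) - \<gamma> (fst z))) \<partial>lborel)"
        by (simp add: add.assoc)
    qed
    also have "\<dots> = (\<integral>\<^sup>+p. \<integral>\<^sup>+z. ?i p * ?i (p + (\<gamma> (snd z) - \<gamma> (fst z))) \<partial>(M \<Otimes>\<^sub>M M) \<partial>lborel)"
      by (subst L.Fubini') simp_all
    also have "\<dots> \<le> (\<integral>\<^sup>+p. ennreal U * ?i p \<partial>lborel)"
    proof (rule nn_integral_mono)
      fix p
      show "(\<integral>\<^sup>+z. ?i p * ?i (p + (\<gamma> (snd z) - \<gamma> (fst z))) \<partial>(M \<Otimes>\<^sub>M M)) \<le> ennreal U * ?i p"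
      proof (cases "p \<in> E")
        case True
        have "(\<integral>\<^sup>+z. ?i p * ?i (p + (\<gamma> (snd z) - \<gamma> (fst z))) \<partial>(M \<Otimes>\<^sub>M M)) = (\<integral>\<^sup>+w. ?i (p + w) \<partial>?\<nu>)"
          using True by (subst nn_integral_distr) simp_all
        also have "\<dots> = (\<integral>\<^sup>+w. indicator {w. p + w \<in> E} w \<partial>?\<nu>)" by (simp add: indicator_def)
        also have "\<dots> = emeasure ?\<nu> {w. p + w \<in> E}"
          using translate_in_sets_borel(2)[OF E, of p] by (intro nn_integral_indicator) simp
        also have "\<dots> \<le> ennreal U"
          using sparse[OF True] by (simp add: \<nu>.emeasure_eq_measure ennreal_leI)
        finally show ?thesis using True by simp
      qed simp
    qed
    also have "\<dots> = ennreal U * emeasure lborel E" by (simp add: nn_integral_cmult)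
    finally show ?thesis .
  qed
  \<comment> \<open>AM-GM in place of Cauchy-Schwarz, using that \<open>T\<close> vanishes off \<open>C - E\<close>\<close>
  have pt: "ennreal (2 * U) * T p \<le> T p * T p + ennreal (U\<^sup>2) * indicator (C - E) p" for p
  proof -
    let ?t = "measure M {x \<in> space M. p + \<gamma> x \<in> E}"
    have "2 * U * ?t \<le> ?t * ?t + U\<^sup>2 * indicator (C - E) p"
    proof (cases "{x \<in> space M. p + \<gamma> x \<in> E} = {}")
      case True
      then show ?thesis by (simp only: True) simp
    next
      case False
      then have "p \<in> C - E" using avoid inC by auto
      then show ?thesis using zero_le_power2[of "?t - U"] by (simp add: power2_eq_square algebra_simps)
    qed
    from ennreal_leI[OF this] show ?thesis
      using U by (auto simp: T_eq ennreal_mult ennreal_plus indicator_def power2_eq_square split: if_splits)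
  qed
  have CE: "emeasure lborel (C - E) = ennreal (measure lborel C - measure lborel E)"
    using fin finE EC
    by (subst emeasure_Diff) (auto simp: emeasure_eq_ennreal_measure ennreal_minus)
  have eE: "emeasure lborel E = ennreal (measure lborel E)"
    using finE by (intro emeasure_eq_ennreal_measure) auto
  have mle: "measure lborel E \<le> measure lborel C"
    using EC fin by (intro measure_mono_fmeasurable fmeasurableI) auto
  have "ennreal (2 * U) * emeasure lborel E = (\<integral>\<^sup>+p. ennreal (2 * U) * T p \<partial>lborel)"
    by (simp add: nn_integral_cmult I1)
  also have "\<dots> \<le> (\<integral>\<^sup>+p. T p * T p + ennreal (U\<^sup>2) * indicator (C - E) p \<partial>lborel)"
    by (intro nn_integral_mono pt)
  also have "\<dots> = (\<integral>\<^sup>+p. T p * T p \<partial>lborel) + ennreal (U\<^sup>2) * emeasure lborel (C - E)"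
    by (subst nn_integral_add) (auto simp: nn_integral_cmult)
  also have "\<dots> \<le> ennreal U * emeasure lborel E + ennreal (U\<^sup>2) * emeasure lborel (C - E)"
    by (intro add_right_mono I2)
  finally have "ennreal (2 * U * measure lborel E)
      \<le> ennreal (U * measure lborel E + U\<^sup>2 * (measure lborel C - measure lborel E))"
    using U mle unfolding CE eE
    by (simp add: ennreal_mult'[symmetric] ennreal_plus[symmetric] del: ennreal_plus)
  then have "2 * U * measure lborel E \<le> U * measure lborel E + U\<^sup>2 * (measure lborel C - measure lborel E)"
    using U mle by (subst (asm) ennreal_le_iff) auto
  \<comment> \<open>One copy of \<open>U * measure lborel E\<close> cancels; the common factor
    \<open>U\<close> is removed last.\<close>
  then have "U * measure lborel E \<le> U * (U * (measure lborel C - measure lborel E))"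
    by (simp add: power2_eq_square algebra_simps)
  then show ?thesis using U by simp
qed

section \<open>The unit curve of the Koranyi norm in a vertical plane\<close>

text \<open>Height of the arc of u^4 + v^2 = 1 over [0,1], that is, of the points of the plane
  subgroup at Koranyi distance 1 from the identity.\<close>

definition kor_profile :: "real \<Rightarrow> real" where
  "kor_profile x = sqrt (1 - x ^ 4)"

definition kor_curve :: "real \<Rightarrow> real \<times> real" where
  "kor_curve x = (x, kor_profile x)"

lemma kor_profile_bounds:
  assumes "0 \<le> x" "x \<le> 1"
  shows "0 \<le> kor_profile x" "kor_profile x \<le> 1"
proof -
  have "0 \<le> x ^ 4" "x ^ 4 \<le> 1" using assms by (simp_all add: power_le_one)
  then show "0 \<le> kor_profile x" "kor_profile x \<le> 1"
    unfolding kor_profile_def by (simp_all only: real_sqrt_ge_0_iff real_sqrt_le_1_iff diff_ge_0_iff_ge)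
qed

lemma has_real_derivative_kor_profile:
  assumes "0 < x" "x < 1"
  shows "(kor_profile has_real_derivative - 2 * x ^ 3 / sqrt (1 - x ^ 4)) (at x)"
proof -
  have "x ^ 4 < 1" using assms by (simp add: power_less_one_iff)
  then show ?thesis
    unfolding kor_profile_def
    by (auto intro!: derivative_eq_intros simp: field_simps)
qed

text \<open>Strict concavity in quantitative form: the cube is superadditive on positive reals, and
  the factor \<open>1 / sqrt (1 - x ^ 4)\<close> is increasing and at least 1.\<close>

lemma kor_profile_derivative_gap:
  assumes "0 < x" "0 < a" "x + a < 1"
  shows "- 2 * (x + a) ^ 3 / sqrt (1 - (x + a) ^ 4) - (- 2 * x ^ 3 / sqrt (1 - x ^ 4)) \<le> - (2 * a ^ 3)"
proof -
  have x4: "x ^ 4 < 1" using assms by (simp add: power_less_one_iff)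
  have y4: "(x + a) ^ 4 < 1" using assms by (simp add: power_less_one_iff)
  have xy: "x ^ 4 \<le> (x + a) ^ 4" using assms by (intro power_mono) auto
  let ?s = "1 / sqrt (1 - x ^ 4)" and ?t = "1 / sqrt (1 - (x + a) ^ 4)"
  have st: "?s \<le> ?t" using x4 y4 xy by (intro divide_left_mono) auto
  have s1: "1 \<le> ?s" using x4 assms by (simp add: le_divide_eq)
  have cube: "x ^ 3 + a ^ 3 \<le> (x + a) ^ 3"
    using assms by (simp add: power3_eq_cube algebra_simps)
  have "a ^ 3 * 1 \<le> ((x + a) ^ 3 - x ^ 3) * ?s"
    using cube s1 assms by (intro mult_mono) auto
  also have "\<dots> \<le> (x + a) ^ 3 * ?t - x ^ 3 * ?s"
    using st assms by (simp only: left_diff_distrib diff_right_mono mult_left_mono zero_le_power add_pos_pos less_imp_le)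
  finally show ?thesis by (simp add: algebra_simps)
qed

text \<open>Mean value theorem for the increment with fixed step \<open>a\<close>, taken as a
  function of the base point.\<close>

lemma kor_profile_increment_gap:
  assumes "0 < x" "x < x'" "0 < a" "x' + a < 1"
  shows "2 * a ^ 3 * (x' - x) \<le> (kor_profile (x + a) - kor_profile x) - (kor_profile (x' + a) - kor_profile x')"
proof -
  let ?f = "\<lambda>x. kor_profile (x + a) - kor_profile x"
  let ?d = "\<lambda>x. - 2 * (x + a) ^ 3 / sqrt (1 - (x + a) ^ 4) - (- 2 * x ^ 3 / sqrt (1 - x ^ 4))"
  have "(?f has_real_derivative ?d z) (at z)" if "x \<le> z" "z \<le> x'" for z
    using that assms
    by (intro DERIV_diff has_real_derivative_kor_profile DERIV_shift[THEN iffD1]) auto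
  from MVT2[OF assms(2) this] obtain z where z: "x < z" "z < x'" "?f x' - ?f x = (x' - x) * ?d z"
    by blast
  have "(x' - x) * ?d z \<le> (x' - x) * (- (2 * a ^ 3))"
    using z assms by (intro mult_left_mono kor_profile_derivative_gap) auto
  then show ?thesis using z(3) by (simp add: algebra_simps)
qed

lemma kor_profile_increment_inverse_Lipschitz:
  assumes "0 < x" "x < 1" "0 < x'" "x' < 1" "0 < x + a" "x + a < 1" "0 < x' + a" "x' + a < 1"
  shows "2 * \<bar>a\<bar> ^ 3 * \<bar>x - x'\<bar> \<le> \<bar>(kor_profile (x + a) - kor_profile x) - (kor_profile (x' + a) - kor_profile x')\<bar>"
  using assms
proof (induction x x' rule: linorder_wlog)
  case (le x x')
  consider "x = x'" | "x < x'" "a = 0" | "x < x'" "a > 0" | "x < x'" "a < 0"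
    using le by linarith
  then show ?case
  proof cases
    case 3
    then show ?thesis using kor_profile_increment_gap[of x x' a] le by simp
  next
    case 4
    \<comment> \<open>For negative \<open>a\<close> the increment at \<open>x\<close> is minus the
      increment with step \<open>- a\<close> at \<open>x + a\<close>.\<close>
    then show ?thesis using kor_profile_increment_gap[of "x + a" "x' + a" "- a"] le by simp
  qed simp_all
next
  case (sym x x')
  then show ?case by (simp add: abs_minus_commute)
qed

text \<open>For a fixed nonzero step the increment is injective with Lipschitz inverse, and
  Lipschitz images of null sets are null.\<close>

lemma kor_profile_increment_preimage_null:
  fixes N :: "real set"
  assumes "N \<in> null_sets lborel" "a \<noteq> 0"
  shows "negligible {x. 0 < x \<and> x < 1 \<and> 0 < x + a \<and> x + a < 1 \<and> kor_profile (x + a) - kor_profile x \<in> N}"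
    (is "negligible ?P")
proof -
  let ?\<psi> = "\<lambda>x. kor_profile (x + a) - kor_profile x"
  have lip: "2 * \<bar>a\<bar> ^ 3 * \<bar>x - x'\<bar> \<le> \<bar>?\<psi> x - ?\<psi> x'\<bar>" if "x \<in> ?P" "x' \<in> ?P" for x x'
    using that by (intro kor_profile_increment_inverse_Lipschitz) auto
  have inj: "inj_on ?\<psi> ?P"
  proof (rule inj_onI)
    fix x x' assume "x \<in> ?P" "x' \<in> ?P" "?\<psi> x = ?\<psi> x'"
    then have "2 * \<bar>a\<bar> ^ 3 * \<bar>x - x'\<bar> \<le> 0" using lip[of x x'] by simp
    then show "x = x'" using assms(2) by (simp add: mult_le_0_iff)
  qed
  have neg: "negligible (?\<psi> ` ?P)"
    by (rule negligible_subset[of N]) (use assms(1) in \<open>auto simp: negligible_iff_null_sets null_sets_completionI\<close>)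
  have "negligible (inv_into ?P ?\<psi> ` ?\<psi> ` ?P)"
  proof (rule negligible_locally_Lipschitz_image[OF _ neg])
    fix v assume v: "v \<in> ?\<psi> ` ?P"
    have "norm (inv_into ?P ?\<psi> w - inv_into ?P ?\<psi> v) \<le> 1 / (2 * \<bar>a\<bar> ^ 3) * norm (w - v)"
      if w: "w \<in> ?\<psi> ` ?P" for w
    proof -
      obtain x x' where x: "x \<in> ?P" "v = ?\<psi> x" "x' \<in> ?P" "w = ?\<psi> x'" using v w by blast
      have "inv_into ?P ?\<psi> v = x" "inv_into ?P ?\<psi> w = x'"
        unfolding x(2,4) by (rule inv_into_f_f[OF inj x(1)], rule inv_into_f_f[OF inj x(3)])
      then show ?thesis
        using lip[OF x(3,1)] assms(2) x(2,4) by (simp add: pos_le_divide_eq mult.commute mult.left_commute)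
    qed
    then show "\<exists>T B. open T \<and> v \<in> T \<and>
        (\<forall>y\<in>?\<psi> ` ?P \<inter> T. norm (inv_into ?P ?\<psi> y - inv_into ?P ?\<psi> v) \<le> B * norm (y - v))"
      by (intro exI[of _ UNIV] exI[of _ "1 / (2 * \<bar>a\<bar> ^ 3)"]) auto
  qed simp
  then show ?thesis by (simp only: inv_into_image_cancel[OF inj order_refl])
qed

section \<open>Law of the difference of two random points of the arc\<close>

abbreviation unit_uniform :: "real measure" where
  "unit_uniform \<equiv> restrict_space lborel {0<..<1}"

lemma prob_space_unit_uniform: "prob_space unit_uniform"
  by (rule prob_spaceI) (simp add: emeasure_restrict_space space_restrict_space)

lemma borel_measurable_kor_profile[measurable]: "kor_profile \<in> borel_measurable borel"
  unfolding kor_profile_def by measurable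

lemma borel_measurable_kor_curve[measurable]: "kor_curve \<in> borel_measurable borel"
  unfolding kor_curve_def by measurable

lemma kor_curve_measurable_unit_uniform: "kor_curve \<in> unit_uniform \<rightarrow>\<^sub>M borel"
  by (rule measurable_restrict_space1) simp

definition kor_curve_difference_law :: "(real \<times> real) measure" where
  "kor_curve_difference_law =
     distr (unit_uniform \<Otimes>\<^sub>M unit_uniform) borel (\<lambda>z. kor_curve (snd z) - kor_curve (fst z))"

lemma sets_kor_curve_difference_law: "sets kor_curve_difference_law = sets borel"
  by (simp add: kor_curve_difference_law_def)

lemma prob_space_kor_curve_difference_law: "prob_space kor_curve_difference_law"
proof -
  interpret M: prob_space unit_uniform by (rule prob_space_unit_uniform)
  interpret MM: pair_prob_space unit_uniform unit_uniform ..
  note kor_curve_measurable_unit_uniform[measurable]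
  show ?thesis unfolding kor_curve_difference_law_def
    by (rule MM.prob_space_distr) measurable
qed

text \<open>In the variables \<open>x\<close> and \<open>a = y - x\<close>, the difference is
  \<open>a\<close> paired with an increment of the profile of step \<open>a\<close>. A null set has
  null slices at almost every \<open>a\<close>, and
  \<open>kor_profile_increment_preimage_null\<close> pulls these back to null sets of
  \<open>x\<close>.\<close>

lemma absolutely_continuous_kor_curve_difference_law:
  "absolutely_continuous lborel kor_curve_difference_law"
  unfolding absolutely_continuous_def
proof
  fix N :: "(real \<times> real) set" assume N: "N \<in> null_sets lborel"
  then have Nb[measurable]: "N \<in> sets borel" by (simp add: null_sets_def)
  interpret M: prob_space unit_uniform by (rule prob_space_unit_uniform)
  interpret MM: pair_prob_space unit_uniform unit_uniform ..
  note kor_curve_measurable_unit_uniform[measurable]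
  let ?I = "indicator {0<..<1} :: real \<Rightarrow> ennreal"
  let ?N = "indicator N :: real \<times> real \<Rightarrow> ennreal"
  have "0 = emeasure (lborel \<Otimes>\<^sub>M lborel) N" using N by (simp add: lborel_prod null_sets_def)
  also have "\<dots> = (\<integral>\<^sup>+a. emeasure lborel (Pair a -` N) \<partial>lborel)"
    by (rule lborel.emeasure_pair_measure_alt) (use Nb in \<open>simp only: lborel_prod sets_lborel\<close>)
  finally have AE: "AE a in lborel. emeasure lborel (Pair a -` N) = 0"
    by (subst (asm) eq_commute, subst (asm) nn_integral_0_iff_AE)
       (auto intro!: lborel.measurable_emeasure_Pair simp: lborel_prod)
  have slice: "(\<integral>\<^sup>+x. ?I x * (?I (x + a) * ?N (kor_curve (x + a) - kor_curve x)) \<partial>lborel) = 0"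
    if "emeasure lborel (Pair a -` N) = 0" "a \<noteq> 0" for a
  proof -
    let ?P = "{x. 0 < x \<and> x < 1 \<and> 0 < x + a \<and> x + a < 1 \<and> kor_profile (x + a) - kor_profile x \<in> Pair a -` N}"
    have "(\<lambda>x::real. (a, x)) \<in> borel_measurable borel"
      by (intro borel_measurable_continuous_onI continuous_intros)
    from measurable_sets[OF this Nb] have "Pair a -` N \<in> sets borel" by simp
    then have "Pair a -` N \<in> null_sets lborel"
      using that by (simp add: null_sets_def)
    then have "negligible ?P"
      using that by (intro kor_profile_increment_preimage_null)
    then have "AE x in lebesgue. x \<notin> ?P"
      unfolding negligible_iff_null_sets by (rule AE_not_in)
    then have "AE x in lborel. x \<notin> ?P" by (simp add: AE_completion_iff)
    then have "AE x in lborel. ?I x * (?I (x + a) * ?N (kor_curve (x + a) - kor_curve x)) = 0"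
      by (rule AE_mp) (auto simp: kor_curve_def indicator_def)
    then show ?thesis by (subst nn_integral_0_iff_AE) auto
  qed
  have "emeasure kor_curve_difference_law N = (\<integral>\<^sup>+z. ?N (kor_curve (snd z) - kor_curve (fst z)) \<partial>(unit_uniform \<Otimes>\<^sub>M unit_uniform))"
    unfolding kor_curve_difference_law_def
    using nn_integral_distr[of "\<lambda>z. kor_curve (snd z) - kor_curve (fst z)" "unit_uniform \<Otimes>\<^sub>M unit_uniform" borel ?N]
    by simp
  also have "\<dots> = (\<integral>\<^sup>+x. \<integral>\<^sup>+y. ?N (kor_curve y - kor_curve x) \<partial>unit_uniform \<partial>unit_uniform)"
    by (subst M.nn_integral_fst[symmetric]) simp_all
  also have "\<dots> = (\<integral>\<^sup>+x. ?I x * (\<integral>\<^sup>+y. ?I y * ?N (kor_curve y - kor_curve x) \<partial>lborel) \<partial>lborel)"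
    by (simp add: nn_integral_restrict_space mult.commute)
  \<comment> \<open>Substitute \<open>y = x + a\<close> in the inner integral, so that the order of
    integration can then be exchanged.\<close>
  also have "\<dots> = (\<integral>\<^sup>+x. ?I x * (\<integral>\<^sup>+a. ?I (x + a) * ?N (kor_curve (x + a) - kor_curve x) \<partial>lborel) \<partial>lborel)"
  proof (rule nn_integral_cong)
    fix x
    have "(\<integral>\<^sup>+a. ?I (a + x) * ?N (kor_curve (a + x) - kor_curve x) \<partial>lborel)
       = (\<integral>\<^sup>+y. ?I y * ?N (kor_curve y - kor_curve x) \<partial>lborel)"
      by (rule nn_integral_lborel_translate[where f="\<lambda>y. ?I y * ?N (kor_curve y - kor_curve x)"]) measurable
    then show "?I x * (\<integral>\<^sup>+y. ?I y * ?N (kor_curve y - kor_curve x) \<partial>lborel)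
      = ?I x * (\<integral>\<^sup>+a. ?I (x + a) * ?N (kor_curve (x + a) - kor_curve x) \<partial>lborel)"
      by (simp add: add.commute)
  qed
  also have "\<dots> = (\<integral>\<^sup>+x. \<integral>\<^sup>+a. ?I x * (?I (x + a) * ?N (kor_curve (x + a) - kor_curve x)) \<partial>lborel \<partial>lborel)"
    by (simp add: nn_integral_cmult)
  also have "\<dots> = (\<integral>\<^sup>+a. \<integral>\<^sup>+x. ?I x * (?I (x + a) * ?N (kor_curve (x + a) - kor_curve x)) \<partial>lborel \<partial>lborel)"
    by (rule lborel_pair.Fubini') measurable
  also have "\<dots> = (\<integral>\<^sup>+(a::real). 0 \<partial>lborel)"
  proof (rule nn_integral_cong_AE)
    \<comment> \<open>The value \<open>a = 0\<close> has to be discarded, since there the increment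
      vanishes identically.\<close>
    show "AE a in lborel. (\<integral>\<^sup>+x. ?I x * (?I (x + a) * ?N (kor_curve (x + a) - kor_curve x)) \<partial>lborel) = 0"
      using AE AE_lborel_singleton[of 0] by eventually_elim (rule slice)
  qed
  finally show "N \<in> null_sets kor_curve_difference_law"
    by (simp add: null_sets_def kor_curve_difference_law_def)
qed

section \<open>The Heisenberg group\<close>

text \<open>The symplectic form of the group law without its factor 1/2, isolated so that
  bilinearity can be used for rewriting.\<close>

definition heis_form :: "complex ^ 'n \<Rightarrow> complex ^ 'n::finite \<Rightarrow> real" where
  "heis_form w z = Im (\<Sum>j\<in>UNIV. w $ j * cnj (z $ j))"

lemma heis_mult_eq: "heis_mult p q = (fst p + fst q, snd p + snd q + heis_form (fst p) (fst q) / 2)"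
  by (simp add: heis_mult_def heis_form_def)

lemma heis_form_add_left: "heis_form (w + w') z = heis_form w z + heis_form w' z"
  by (simp add: heis_form_def algebra_simps sum.distrib)

lemma heis_form_add_right: "heis_form w (z + z') = heis_form w z + heis_form w z'"
  by (simp add: heis_form_def algebra_simps sum.distrib)

lemma heis_form_minus_left: "heis_form (- w) z = - heis_form w z"
  using heis_form_add_left[of w "- w" z] by (simp add: heis_form_def)

lemma heis_form_minus_right: "heis_form w (- z) = - heis_form w z"
  using heis_form_add_right[of w z "- z"] by (simp add: heis_form_def)

lemma heis_form_self: "heis_form z z = 0"
  by (simp add: heis_form_def complex_mult_cnj)

lemma abs_heis_form_le: "\<bar>heis_form w z\<bar> \<le> norm w * norm z"
proof -
  \<comment> \<open>An imaginary part is the real part after multiplication by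
    \<open>- \<i>\<close>, so the form is a real inner product and Cauchy-Schwarz applies.\<close>
  have "heis_form w z = (\<chi> j. - \<i> * w $ j) \<bullet> z"
    unfolding heis_form_def inner_vec_def Im_sum
    by (intro sum.cong) (simp_all add: inner_complex_def)
  also have "\<bar>\<dots>\<bar> \<le> norm (\<chi> j. - \<i> * w $ j) * norm z" by (rule Cauchy_Schwarz_ineq2)
  also have "norm (\<chi> j. - \<i> * w $ j) = norm w" by (simp add: norm_vec_def norm_mult)
  finally show ?thesis .
qed

lemma heis_mult_assoc: "heis_mult (heis_mult p q) r = heis_mult p (heis_mult q r)"
  by (simp add: heis_mult_eq heis_form_add_left heis_form_add_right add_divide_distrib algebra_simps)

lemma heis_mult_inv_cancel_left: "heis_mult (heis_inv p) (heis_mult p q) = q"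
  by (cases q) (simp add: heis_mult_eq heis_inv_def heis_form_add_right heis_form_minus_left heis_form_self)

lemma heis_mult_cancel_right: "heis_mult (heis_mult p q) (heis_inv q) = p"
  by (cases p) (simp add: heis_mult_eq heis_inv_def heis_form_add_left heis_form_minus_right heis_form_self)

lemma continuous_on_heis_form [continuous_intros]:
  "continuous_on S f \<Longrightarrow> continuous_on S g \<Longrightarrow> continuous_on S (\<lambda>x. heis_form (f x) (g x))"
  unfolding heis_form_def by (intro continuous_intros)

lemma continuous_on_heis_mult [continuous_intros]:
  "continuous_on S f \<Longrightarrow> continuous_on S g \<Longrightarrow> continuous_on S (\<lambda>x. heis_mult (f x) (g x))"
  unfolding heis_mult_eq by (intro continuous_intros) auto

lemma borel_measurable_heis_form:
  "(\<lambda>z. heis_form w z) \<in> borel_measurable borel" "(\<lambda>w. heis_form w z) \<in> borel_measurable borel"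
  by (intro borel_measurable_continuous_onI continuous_intros)+

lemma borel_measurable_heis_mult:
  "(\<lambda>q. heis_mult p q) \<in> borel_measurable borel" "(\<lambda>p. heis_mult p q) \<in> borel_measurable borel"
  by (intro borel_measurable_continuous_onI continuous_intros)+

text \<open>For fixed \<open>q\<close> the twist depends on \<open>fst p\<close> alone, so the
  translation is a shear; left translations are treated alike.\<close>

lemma distr_heis_mult_right: "distr lborel borel (\<lambda>p. heis_mult p q) = lborel"
proof -
  have "(\<lambda>p. heis_mult p q) = (\<lambda>p. (fst p + fst q, snd p + (snd q + heis_form (fst p) (fst q) / 2)))"
    by (auto simp: heis_mult_eq)
  moreover have "(\<lambda>z. snd q + heis_form z (fst q) / 2) \<in> borel_measurable borel"
    by (intro borel_measurable_add borel_measurable_divide borel_measurable_const borel_measurable_heis_form(2))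
  ultimately show ?thesis using distr_shear_lborel by simp
qed

lemma distr_heis_mult_left: "distr lborel borel (\<lambda>p. heis_mult q p) = lborel"
proof -
  have "(\<lambda>p. heis_mult q p) = (\<lambda>p. (fst p + fst q, snd p + (snd q + heis_form (fst q) (fst p) / 2)))"
    by (auto simp: heis_mult_eq)
  moreover have "(\<lambda>z. snd q + heis_form (fst q) z / 2) \<in> borel_measurable borel"
    by (intro borel_measurable_add borel_measurable_divide borel_measurable_const borel_measurable_heis_form(1))
  ultimately show ?thesis using distr_shear_lborel by simp
qed

lemma emeasure_heis_mult_vimage:
  assumes "X \<in> sets borel"
  shows "emeasure lborel {p. heis_mult p q \<in> X} = emeasure lborel X"
    and "emeasure lborel {p. heis_mult q p \<in> X} = emeasure lborel X"
proof -
  have "emeasure (distr lborel borel (\<lambda>p. heis_mult p q)) X = emeasure lborel {p. heis_mult p q \<in> X}"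
    using borel_measurable_heis_mult(2)[of q] assms by (simp add: emeasure_distr vimage_def)
  then show "emeasure lborel {p. heis_mult p q \<in> X} = emeasure lborel X"
    by (simp add: distr_heis_mult_right)
  have "emeasure (distr lborel borel (\<lambda>p. heis_mult q p)) X = emeasure lborel {p. heis_mult q p \<in> X}"
    using borel_measurable_heis_mult(1)[of q] assms by (simp add: emeasure_distr vimage_def)
  then show "emeasure lborel {p. heis_mult q p \<in> X} = emeasure lborel X"
    by (simp add: distr_heis_mult_left)
qed

section \<open>Cylinders as product-shaped substitutes for Koranyi balls\<close>

definition heis_cyl :: "real \<Rightarrow> 'n::finite heis set" where
  "heis_cyl r = ball 0 r \<times> {- r\<^sup>2<..<r\<^sup>2}"

lemma heis_cyl_borel: "heis_cyl r \<in> sets borel"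
  unfolding heis_cyl_def by (intro borel_open open_Times) auto

text \<open>The exponent is the homogeneous dimension 2n + 2: the vertical side grows quadratically
  in \<open>r\<close>.\<close>

lemma emeasure_heis_cyl:
  assumes "r > 0"
  shows "emeasure lborel (heis_cyl r :: 'n::finite heis set) =
    ennreal (2 * measure lborel (ball (0 :: complex ^ 'n) 1) * r ^ (DIM(complex ^ 'n) + 2))"
proof -
  have "emeasure lborel (heis_cyl r :: 'n heis set) = emeasure (lborel \<Otimes>\<^sub>M lborel) (heis_cyl r :: 'n heis set)"
    by (simp add: lborel_prod)
  also have "\<dots> = emeasure lborel (ball (0 :: complex ^ 'n) r) * emeasure lborel {- r\<^sup>2<..<r\<^sup>2}"
    unfolding heis_cyl_def by (rule lborel.emeasure_pair_measure_Times) auto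
  also have "emeasure lborel (ball (0 :: complex ^ 'n) r) = ennreal (measure lborel (ball (0 :: complex ^ 'n) 1) * r ^ DIM(complex ^ 'n))"
    using assms by (simp add: emeasure_ball content_ball)
  also have "emeasure lborel {- r\<^sup>2<..<r\<^sup>2} = ennreal (2 * r\<^sup>2)" by simp
  finally show ?thesis
    using assms by (simp add: ennreal_mult[symmetric] power_add mult_ac power2_eq_square)
qed

lemma kor_norm_less_iff:
  assumes "r > 0"
  shows "kor_norm p < r \<longleftrightarrow> norm (fst p) ^ 4 + (snd p)\<^sup>2 < r ^ 4"
proof -
  have r: "root 4 (r ^ 4) = r" using assms by (intro real_root_power_cancel) simp_all
  have "kor_norm p < r \<longleftrightarrow> root 4 (norm (fst p) ^ 4 + (snd p)\<^sup>2) < root 4 (r ^ 4)"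
    by (simp only: r kor_norm_def)
  then show ?thesis by (simp only: real_root_less_iff zero_less_numeral)
qed

text \<open>Both terms under the root are at most \<open>r ^ 4 / 16\<close>. Together with
  \<open>kor_norm_less_imp\<close> this traps the ball of radius \<open>r\<close> about the identity
  between cylinders of radii \<open>r / 2\<close> and \<open>r\<close>.\<close>

lemma heis_cyl_subset_kor:
  assumes "r > 0" "p \<in> heis_cyl (r / 2)"
  shows "kor_norm p < r"
proof -
  have "norm (fst p) < r / 2" "\<bar>snd p\<bar> < (r / 2)\<^sup>2"
    using assms(2) by (auto simp: heis_cyl_def mem_Times_iff)
  then have "norm (fst p) ^ 4 \<le> (r / 2) ^ 4" "\<bar>snd p\<bar>\<^sup>2 \<le> ((r / 2)\<^sup>2)\<^sup>2"
    by (intro power_mono[OF less_imp_le]; simp)+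
  then have "norm (fst p) ^ 4 + (snd p)\<^sup>2 \<le> r ^ 4 / 8" by (simp add: power_divide)
  also have "\<dots> < r ^ 4" using assms by simp
  finally show ?thesis using assms by (simp add: kor_norm_less_iff)
qed

lemma kor_norm_less_imp:
  assumes "r > 0" "kor_norm p < r"
  shows "norm (fst p) < r" "\<bar>snd p\<bar> < r\<^sup>2"
proof -
  have *: "norm (fst p) ^ 4 + (snd p)\<^sup>2 < r ^ 4"
    using kor_norm_less_iff[OF assms(1)] assms(2) by blast
  have "norm (fst p) ^ 4 < r ^ 4"
    by (rule le_less_trans[OF _ *]) (simp only: le_add_same_cancel1 zero_le_power2)
  then show "norm (fst p) < r" by (rule power_less_imp_less_base) (use assms in simp)
  have "(snd p)\<^sup>2 < r ^ 4"
    by (rule le_less_trans[OF _ *]) (simp only: le_add_same_cancel2 zero_le_power norm_ge_zero)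
  moreover have "(r\<^sup>2)\<^sup>2 = r ^ 4" by (simp only: power_mult[symmetric]) simp
  ultimately have "\<bar>snd p\<bar>\<^sup>2 < (r\<^sup>2)\<^sup>2" by (simp only: power2_abs)
  then show "\<bar>snd p\<bar> < r\<^sup>2" by (rule power_less_imp_less_base) (rule zero_le_power2)
qed

lemma kor_ball_borel: "kor_ball a r \<in> sets borel"
proof -
  have "open {x. kor_norm (heis_mult (heis_inv a) x) < r}"
    unfolding kor_norm_def by (intro open_Collect_less continuous_intros)
  then show ?thesis by (simp add: kor_ball_def)
qed

lemma emeasure_heis_cyl_le_kor_ball:
  fixes a :: "'n::finite heis"
  assumes "r > 0"
  shows "emeasure lborel (heis_cyl (r / 2) :: 'n heis set) \<le> emeasure lborel (kor_ball a r)"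
proof -
  have "emeasure lborel {x. heis_mult (heis_inv a) x \<in> heis_cyl (r / 2)} \<le> emeasure lborel (kor_ball a r)"
  proof (rule emeasure_mono)
    show "{x. heis_mult (heis_inv a) x \<in> heis_cyl (r / 2)} \<subseteq> kor_ball a r"
      unfolding kor_ball_def using heis_cyl_subset_kor[OF assms] by blast
  qed (simp add: kor_ball_borel)
  then show ?thesis by (simp add: emeasure_heis_mult_vimage(2) heis_cyl_borel)
qed

lemma emeasure_kor_ball_finite:
  assumes "r > 0"
  shows "emeasure lborel (kor_ball (a :: 'n::finite heis) r) < \<infinity>"
proof -
  have "emeasure lborel (kor_ball a r) \<le> emeasure lborel {x. heis_mult (heis_inv a) x \<in> heis_cyl r}"
  proof (rule emeasure_mono)
    show "kor_ball a r \<subseteq> {x. heis_mult (heis_inv a) x \<in> heis_cyl r}"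
    proof
      fix x assume "x \<in> kor_ball a r"
      then have "kor_norm (heis_mult (heis_inv a) x) < r" by (simp add: kor_ball_def)
      from kor_norm_less_imp[OF assms this] show "x \<in> {x. heis_mult (heis_inv a) x \<in> heis_cyl r}"
        by (simp add: heis_cyl_def mem_Times_iff abs_less_iff)
    qed
    show "{x. heis_mult (heis_inv a) x \<in> heis_cyl r} \<in> sets lborel"
      using measurable_sets[OF borel_measurable_heis_mult(1)[of "heis_inv a"] heis_cyl_borel]
      by (simp add: vimage_def)
  qed
  also have "\<dots> < \<infinity>"
    using assms by (simp add: emeasure_heis_mult_vimage(2) heis_cyl_borel emeasure_heis_cyl)
  finally show ?thesis .
qed

section \<open>Sections by left translates of a vertical plane\<close>

text \<open>Here \<open>undefined\<close> serves as an arbitrary but fixed coordinate index.\<close>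

definition heis_plane :: "real \<times> real \<Rightarrow> 'n::finite heis" where
  "heis_plane p = (axis undefined (of_real (fst p)), snd p)"

text \<open>The Heisenberg dilation in plane coordinates; the quadratic vertical factor is the one
  under which the Koranyi norm is homogeneous.\<close>

definition par_dil :: "real \<Rightarrow> real \<times> real \<Rightarrow> real \<times> real" where
  "par_dil r p = (r * fst p, r\<^sup>2 * snd p)"

text \<open>The part of \<open>A\<close> in the coset of \<open>q\<close>, in coordinates where, for
  positive \<open>r\<close>, distance \<open>r\<close> becomes distance 1.\<close>

definition plane_section :: "'n::finite heis set \<Rightarrow> 'n heis \<Rightarrow> real \<Rightarrow> (real \<times> real) set" where
  "plane_section A q r = {p. heis_mult q (heis_plane (par_dil r p)) \<in> A}"

text \<open>For positive \<open>r\<close> the unit square stands for a box of sides \<open>r\<close>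
  and \<open>r\<^sup>2\<close> in the coset, with corner \<open>q\<close>; hence a density at scale
  \<open>r\<close>.\<close>

definition plane_density :: "'n::finite heis set \<Rightarrow> 'n heis \<Rightarrow> real \<Rightarrow> real" where
  "plane_density A q r = measure lborel (plane_section A q r \<inter> {0..1} \<times> {0..1})"

lemma par_dil_add: "par_dil r (p + p') = par_dil r p + par_dil r p'"
  by (simp add: par_dil_def algebra_simps)

lemma par_dil_mult: "par_dil (r * s) p = par_dil r (par_dil s p)"
  by (simp add: par_dil_def algebra_simps)

text \<open>The reason the group law on the plane is plain addition: products of real coordinates
  have no imaginary part.\<close>

lemma heis_form_axis_real: "heis_form (axis k (of_real u)) (axis k (of_real v)) = 0"
  unfolding heis_form_def Im_sum by (intro sum.neutral) (simp add: axis_def)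

lemma heis_plane_add: "heis_mult (heis_plane p) (heis_plane p') = heis_plane (p + p')"
proof -
  have "axis k (complex_of_real u) + axis k (of_real v) = axis k (of_real (u + v))" for k u v
    by (simp add: axis_def vec_eq_iff)
  then show ?thesis by (simp add: heis_mult_eq heis_plane_def heis_form_axis_real)
qed

lemma norm_fst_heis_plane: "norm (fst (heis_plane p)) = \<bar>fst p\<bar>"
  by (simp add: heis_plane_def norm_eq_sqrt_inner inner_axis_axis inner_complex_def)

text \<open>Left invariance removes \<open>q\<close>, and additivity on the plane leaves only the
  difference of coordinates.\<close>

lemma kor_dist_heis_plane:
  "kor_dist (heis_mult q (heis_plane p)) (heis_mult q (heis_plane p')) = root 4 ((fst (p - p')) ^ 4 + (snd (p - p'))\<^sup>2)"
proof -
  have "heis_mult q (heis_plane p) = heis_mult (heis_mult q (heis_plane p')) (heis_plane (p - p'))"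
    by (simp add: heis_mult_assoc heis_plane_add)
  then have "kor_dist (heis_mult q (heis_plane p)) (heis_mult q (heis_plane p')) = kor_norm (heis_plane (p - p') :: 'a heis)"
    by (simp add: kor_dist_def heis_mult_inv_cancel_left)
  also have "\<dots> = root 4 (\<bar>fst (p - p')\<bar> ^ 4 + (snd (p - p'))\<^sup>2)"
    unfolding kor_norm_def norm_fst_heis_plane by (simp add: heis_plane_def)
  finally show ?thesis by simp
qed

lemma continuous_on_heis_plane_par_dil [continuous_intros]:
  assumes "continuous_on S f"
  shows "continuous_on S (\<lambda>x. heis_plane (par_dil r (f x)))"
proof -
  have *: "continuous_on S (\<lambda>x. complex_of_real (r * fst (f x)))"
    by (intro continuous_intros assms)
  have "continuous_on S (\<lambda>x. axis k (complex_of_real (r * fst (f x))))" for k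
    unfolding axis_def
  proof (rule continuous_on_vec_lambda)
    show "continuous_on S (\<lambda>x. if j = k then complex_of_real (r * fst (f x)) else 0)" for j
      using * by (cases "j = k") auto
  qed
  then show ?thesis unfolding heis_plane_def par_dil_def fst_conv snd_conv
    by (intro continuous_intros assms)
qed

lemma plane_section_borel:
  assumes "A \<in> sets borel"
  shows "plane_section A q r \<in> sets borel"
proof -
  have "(\<lambda>p. heis_mult q (heis_plane (par_dil r p))) \<in> borel_measurable borel"
    by (intro borel_measurable_continuous_onI continuous_intros)
  from measurable_sets[OF this assms] show ?thesis by (simp add: plane_section_def vimage_def)
qed

text \<open>A translated section is a section with another base point, so bounds over all
  \<open>q\<close> cover all translates.\<close>

lemma plane_section_translate:
  "{w. p + w \<in> plane_section A q r} = plane_section A (heis_mult q (heis_plane (par_dil r p))) r"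
  by (simp add: plane_section_def par_dil_add heis_mult_assoc heis_plane_add)

lemma emeasure_lborel_rectangle:
  assumes "a \<le> b" "c \<le> (d::real)"
  shows "emeasure lborel ({a..b} \<times> {c..d}) = ennreal ((b - a) * (d - c))"
proof -
  have "emeasure lborel ({a..b} \<times> {c..d}) = emeasure (lborel \<Otimes>\<^sub>M lborel) ({a..b} \<times> {c..d})"
    by (simp add: lborel_prod)
  also have "\<dots> = emeasure lborel {a..b} * emeasure lborel {c..d}"
    by (rule lborel.emeasure_pair_measure_Times) auto
  finally show ?thesis using assms by (simp add: ennreal_mult)
qed

lemma rectangle_borel: "{a..b} \<times> {c..d} \<in> sets (borel :: (real \<times> real) measure)"
  by (intro borel_closed closed_Times) auto

lemma emeasure_plane_section_le_1:
  "emeasure lborel (plane_section A q r \<inter> {0..1} \<times> {0..1}) \<le> 1"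
  using emeasure_mono[of "plane_section A q r \<inter> {0..1} \<times> {0..1}" "{0..1} \<times> {0..1}" lborel]
  by (simp add: rectangle_borel emeasure_lborel_rectangle)

lemma emeasure_plane_section:
  "emeasure lborel (plane_section A q r \<inter> {0..1} \<times> {0..1}) = ennreal (plane_density A q r)"
  unfolding plane_density_def
  by (rule emeasure_eq_ennreal_measure) (use emeasure_plane_section_le_1[of A q r] in \<open>auto simp: top_unique\<close>)

lemma plane_density_bounds: "0 \<le> plane_density A q r" "plane_density A q r \<le> 1"
  using emeasure_plane_section_le_1[of A q r]
  by (simp_all add: plane_density_def emeasure_plane_section[unfolded plane_density_def])

text \<open>Dilations compose multiplicatively, so a box of side \<open>l\<close> at scale
  \<open>r\<close> is the unit square at scale \<open>r * l\<close>; the Jacobian is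
  \<open>l * l\<^sup>2\<close>.\<close>

lemma measure_plane_section_rectangle:
  assumes A: "A \<in> sets borel" and l: "l > 0"
  shows "measure lborel (plane_section A q r \<inter> {0..l} \<times> {0..l\<^sup>2}) = l ^ 3 * plane_density A q (r * l)"
proof -
  have "emeasure lborel (plane_section A q r \<inter> {0..l} \<times> {0..l\<^sup>2}) = ennreal (l * l\<^sup>2) *
    emeasure lborel {p. (l * fst p, l\<^sup>2 * snd p) \<in> plane_section A q r \<inter> {0..l} \<times> {0..l\<^sup>2}}"
    using l by (intro emeasure_lborel_scale_prod) (auto intro: sets.Int plane_section_borel[OF A] rectangle_borel)
  also have "{p. (l * fst p, l\<^sup>2 * snd p) \<in> plane_section A q r \<inter> {0..l} \<times> {0..l\<^sup>2}}
     = plane_section A q (r * l) \<inter> {0..1} \<times> {0..1}"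
    using l by (auto simp: plane_section_def par_dil_mult par_dil_def[of l] zero_le_mult_iff mem_Times_iff)
  finally have "emeasure lborel (plane_section A q r \<inter> {0..l} \<times> {0..l\<^sup>2}) = ennreal (l ^ 3 * plane_density A q (r * l))"
    using l plane_density_bounds by (simp add: emeasure_plane_section ennreal_mult' power3_eq_cube power2_eq_square mult.assoc)
  then show ?thesis
    using l plane_density_bounds(1)[of A q "r * l"] by (simp add: measure_def)
qed

section \<open>Transfer of density from balls to coset boxes\<close>

lemma kor_ball_shift_subset:
  assumes "0 < S" "S \<le> R" and p: "p \<in> {0..1} \<times> {0..1}"
    and q: "heis_mult q (heis_plane (par_dil S p)) \<in> kor_ball x R"
  shows "heis_mult (heis_inv x) q \<in> heis_cyl (2 * R)"
proof -
  define b where "b = (heis_plane (par_dil S p) :: 'a heis)"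
  define g where "g = heis_mult (heis_inv x) (heis_mult q b)"
  have "kor_norm g < R" using q by (simp add: kor_ball_def g_def b_def)
  from kor_norm_less_imp[OF _ this] assms have g: "norm (fst g) < R" "\<bar>snd g\<bar> < R\<^sup>2" by auto
  have p01: "0 \<le> fst p" "fst p \<le> 1" "0 \<le> snd p" "snd p \<le> 1" using p by auto
  have b1: "norm (fst b) \<le> R"
    unfolding b_def norm_fst_heis_plane using p01 assms
    by (simp add: par_dil_def) (metis dual_order.trans less_imp_le mult_left_le)
  have "S\<^sup>2 * snd p \<le> R\<^sup>2 * 1" using p01 assms by (intro mult_mono power_mono) auto
  then have b2: "\<bar>snd b\<bar> \<le> R\<^sup>2" using p01 by (simp add: b_def heis_plane_def par_dil_def)
  have eq: "heis_mult (heis_inv x) q = heis_mult g (heis_inv b)"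
    unfolding g_def by (simp add: heis_mult_cancel_right flip: heis_mult_assoc)
  have f: "\<bar>heis_form (fst g) (fst b)\<bar> \<le> R * R"
    using abs_heis_form_le[of "fst g" "fst b"] mult_mono[of "norm (fst g)" R "norm (fst b)" R] g b1 assms by simp
  have "fst (heis_mult g (heis_inv b)) = fst g - fst b"
    by (simp add: heis_mult_eq heis_inv_def)
  then have 1: "norm (fst (heis_mult g (heis_inv b))) < 2 * R"
    using norm_triangle_ineq4[of "fst g" "fst b"] g b1 by simp
  have "snd (heis_mult g (heis_inv b)) = snd g - snd b - heis_form (fst g) (fst b) / 2"
    by (simp add: heis_mult_eq heis_inv_def heis_form_minus_right)
  \<comment> \<open>The three terms contribute at most one, one and one half times
    \<open>R\<^sup>2\<close>.\<close>
  moreover have "\<bar>snd g - snd b - heis_form (fst g) (fst b) / 2\<bar> < 4 * R\<^sup>2"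
    using g(2) b2 f unfolding power2_eq_square by linarith
  ultimately have "\<bar>snd (heis_mult g (heis_inv b))\<bar> < (2 * R)\<^sup>2" by (simp add: power_mult_distrib)
  with 1 show ?thesis by (simp add: eq heis_cyl_def mem_Times_iff abs_less_iff)
qed

text \<open>Right translation of the set by the points of a box preserves measure, and Fubini turns
  the average over the box into an integral of coset densities over base points near
  \<open>x\<close>. The constant compares cylinders of radii \<open>2 * R\<close> and
  \<open>R / 2\<close>. Read contrapositively, a dense ball forces a dense coset box at every scale
  up to \<open>R\<close>.\<close>

lemma plane_density_lower_bound:
  fixes A :: "'n::finite heis set"
  assumes A[measurable]: "A \<in> sets borel" and S: "0 < S" "S \<le> R"
    and c: "c * measure lborel (kor_ball x R) \<le> measure lborel (A \<inter> kor_ball x R)" "c \<ge> 0"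
    and d: "\<And>q. plane_density A q S \<le> d"
  shows "c \<le> 4 ^ (DIM(complex ^ 'n) + 2) * d"
proof -
  have R: "R > 0" using S by simp
  have d0: "d \<ge> 0" using d[of 0] plane_density_bounds(1)[of A 0 S] by linarith
  define Q where "Q = {0..1::real} \<times> {0..1::real}"
  have Q[measurable]: "Q \<in> sets borel" unfolding Q_def by (rule rectangle_borel)
  define K where "K = {q. heis_mult (heis_inv x) q \<in> heis_cyl (2 * R)}"
  have K[measurable]: "K \<in> sets borel"
    using measurable_sets[OF borel_measurable_heis_mult(1)[of "heis_inv x"] heis_cyl_borel[of "2 * R"]]
    by (simp add: K_def vimage_def)
  define B where "B = A \<inter> kor_ball x R"
  have B[measurable]: "B \<in> sets borel" unfolding B_def by (intro sets.Int A kor_ball_borel)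
  have eK: "emeasure lborel K = emeasure lborel (heis_cyl (2 * R) :: 'n heis set)"
    unfolding K_def by (rule emeasure_heis_mult_vimage(2)[OF heis_cyl_borel])
  let ?b = "\<lambda>p. heis_plane (par_dil S p) :: 'n heis"
  have "(\<lambda>z::('n heis) \<times> (real \<times> real). heis_mult (fst z) (?b (snd z))) \<in> borel_measurable borel"
    by (intro borel_measurable_continuous_onI continuous_intros)
  then have m[measurable]: "(\<lambda>z::('n heis) \<times> (real \<times> real). heis_mult (fst z) (?b (snd z))) \<in> borel \<Otimes>\<^sub>M borel \<rightarrow>\<^sub>M borel"
    by (simp only: borel_prod)
  have jm: "(\<lambda>(q, p). indicator K q * (indicator Q p * indicator A (heis_mult q (?b p))) :: ennreal)
      \<in> borel_measurable (lborel \<Otimes>\<^sub>M lborel)"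
    using measurable_compose[OF m borel_measurable_indicator[OF A, where 'b=ennreal]]
    by (auto simp: split_beta' intro!: borel_measurable_times_ennreal measurable_compose[OF measurable_fst borel_measurable_indicator]
       measurable_compose[OF measurable_snd borel_measurable_indicator])
  have "ennreal (measure lborel B) = emeasure lborel B"
    using emeasure_mono[of B "kor_ball x R" lborel] emeasure_kor_ball_finite[OF R, of x] kor_ball_borel[of x R]
    by (intro emeasure_eq_ennreal_measure[symmetric]) (auto simp: B_def top_unique)
  \<comment> \<open>\<open>Q\<close> has measure 1, so this only introduces the averaging variable
    \<open>p\<close>.\<close>
  also have "\<dots> = (\<integral>\<^sup>+p. indicator Q p * emeasure lborel B \<partial>lborel)"
  proof -
    have "emeasure lborel Q = 1" unfolding Q_def by (simp add: emeasure_lborel_rectangle)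
    then show ?thesis by (simp add: nn_integral_multc)
  qed
  also have "\<dots> = (\<integral>\<^sup>+p. \<integral>\<^sup>+q. indicator Q p * indicator B (heis_mult q (?b p)) \<partial>lborel \<partial>lborel)"
  proof (intro nn_integral_cong)
    fix p
    have "(\<lambda>q. heis_mult q (?b p)) \<in> borel_measurable borel" by (rule borel_measurable_heis_mult(2))
    then have mb: "(\<lambda>q. indicator B (heis_mult q (?b p)) :: ennreal) \<in> borel_measurable borel"
      by (rule measurable_compose[OF _ borel_measurable_indicator[OF B]])
    have "emeasure lborel B = emeasure lborel {q. heis_mult q (?b p) \<in> B}"
      by (rule emeasure_heis_mult_vimage(1)[OF B, symmetric])
    also have "\<dots> = (\<integral>\<^sup>+q. indicator {q. heis_mult q (?b p) \<in> B} q \<partial>lborel)"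
      using measurable_sets[OF borel_measurable_heis_mult(2) B] by (intro nn_integral_indicator[symmetric]) (simp add: vimage_def)
    also have "\<dots> = (\<integral>\<^sup>+q. indicator B (heis_mult q (?b p)) \<partial>lborel)"
      by (simp add: indicator_def)
    finally show "indicator Q p * emeasure lborel B = (\<integral>\<^sup>+q. indicator Q p * indicator B (heis_mult q (?b p)) \<partial>lborel)"
      using mb by (simp add: nn_integral_cmult)
  qed
  \<comment> \<open>Only base points in \<open>K\<close> can be carried into the ball by a point of
    the box.\<close>
  also have "\<dots> \<le> (\<integral>\<^sup>+p. \<integral>\<^sup>+q. indicator K q * (indicator Q p * indicator A (heis_mult q (?b p))) \<partial>lborel \<partial>lborel)"
  proof (intro nn_integral_mono)
    fix p q
    have "q \<in> K" if "p \<in> Q" "heis_mult q (?b p) \<in> B"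
      unfolding K_def mem_Collect_eq
      using that kor_ball_shift_subset[OF S, of p q x] unfolding Q_def B_def by blast
    then show "(indicator Q p * indicator B (heis_mult q (?b p)) :: ennreal)
        \<le> indicator K q * (indicator Q p * indicator A (heis_mult q (?b p)))"
      by (auto simp: indicator_def B_def)
  qed
  also have "\<dots> = (\<integral>\<^sup>+q. \<integral>\<^sup>+p. indicator K q * (indicator Q p * indicator A (heis_mult q (?b p))) \<partial>lborel \<partial>lborel)"
    using lborel_pair.Fubini'[OF jm] .
  also have "\<dots> \<le> (\<integral>\<^sup>+q. ennreal d * indicator K q \<partial>lborel)"
  proof (rule nn_integral_mono)
    fix q
    have "(\<integral>\<^sup>+p. indicator K q * (indicator Q p * indicator A (heis_mult q (?b p))) \<partial>lborel)
       = (\<integral>\<^sup>+p. indicator K q * indicator (plane_section A q S \<inter> Q) p \<partial>lborel)"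
      by (intro nn_integral_cong) (auto simp: plane_section_def indicator_def)
    also have "\<dots> = indicator K q * emeasure lborel (plane_section A q S \<inter> Q)"
      using plane_section_borel[OF A] Q by (intro nn_integral_cmult_indicator) auto
    also have "\<dots> \<le> ennreal d * indicator K q"
      unfolding Q_def emeasure_plane_section using d[of q] by (auto simp: indicator_def ennreal_leI)
    finally show "(\<integral>\<^sup>+p. indicator K q * (indicator Q p * indicator A (heis_mult q (?b p))) \<partial>lborel) \<le> ennreal d * indicator K q" .
  qed
  also have "\<dots> = ennreal d * emeasure lborel K" by (simp add: nn_integral_cmult_indicator)
  finally have up: "ennreal (measure lborel B) \<le> ennreal d * emeasure lborel K" .
  define v where "v = 2 * measure lborel (ball (0 :: complex ^ 'n) 1)"
  define D where "D = DIM(complex ^ 'n) + 2"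
  have v: "v > 0" unfolding v_def by (simp add: content_ball)
  have cyl: "emeasure lborel (heis_cyl r :: 'n heis set) = ennreal (v * r ^ D)" if "r > 0" for r
    unfolding v_def D_def using that by (rule emeasure_heis_cyl)
  have "ennreal (measure lborel B) \<le> ennreal (d * (v * (2 * R) ^ D))"
    using up cyl[of "2 * R"] R d0 v by (simp only: eK ennreal_mult'' ennreal_mult' mult_pos_pos zero_less_numeral)
  then have "measure lborel B \<le> d * (v * (2 * R) ^ D)"
    using R d0 v by (subst (asm) ennreal_le_iff) simp_all
  moreover have "v * (R / 2) ^ D \<le> measure lborel (kor_ball x R)"
  proof -
    have "ennreal (v * (R / 2) ^ D) \<le> emeasure lborel (kor_ball x R)"
      using emeasure_heis_cyl_le_kor_ball[OF R, of x] cyl[of "R / 2"] R by (simp only: half_gt_zero)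
    also have "\<dots> = ennreal (measure lborel (kor_ball x R))"
      using emeasure_kor_ball_finite[OF R, of x] by (intro emeasure_eq_ennreal_measure) auto
    finally show ?thesis using v R by simp
  qed
  ultimately have "c * (v * (R / 2) ^ D) \<le> d * (v * (2 * R) ^ D)"
    using c mult_left_mono[of "v * (R / 2) ^ D" "measure lborel (kor_ball x R)" c] by (simp add: B_def)
  also have "(2 * R) ^ D = 4 ^ D * (R / 2) ^ D" by (subst power_mult_distrib[symmetric]) simp
  finally have "c * (v * (R / 2) ^ D) \<le> (4 ^ D * d) * (v * (R / 2) ^ D)" by (simp add: mult_ac)
  moreover have "v * (R / 2) ^ D > 0" using v R by simp
  ultimately show ?thesis unfolding D_def[symmetric] by (simp only: mult_le_cancel_right_pos)
qed

section \<open>Large distances\<close>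

text \<open>Integrate \<open>shift\<close> over \<open>X\<close> and exchange the integrals: for
  each fixed \<open>x\<close> the integral over \<open>b\<close> is the quantity bounded by
  \<open>avg\<close>.\<close>

lemma measure_le_shifted_average:
  fixes N :: "'a::euclidean_space measure"
  assumes "prob_space N" and N[measurable_cong, simp]: "sets N = sets borel"
    and P[measurable]: "P \<in> sets borel" and X[measurable]: "X \<in> sets borel"
    and fin: "emeasure lborel X < \<infinity>" and pos: "measure lborel X > 0" and nn: "e \<ge> 0" "u \<ge> 0"
    and shift: "\<And>b. b \<in> X \<Longrightarrow> measure N P \<le> measure N {x. x + b \<in> P} + e"
    and avg: "\<And>x. measure lborel ({b. x + b \<in> P} \<inter> X) \<le> u * measure lborel X"
  shows "measure N P \<le> u + e"
proof -
  interpret N: prob_space N by fact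
  interpret L: pair_sigma_finite "lborel :: 'a measure" N ..
  have sp: "space N = UNIV" using sets_eq_imp_space_eq[OF N] by simp
  let ?X = "indicator X :: 'a \<Rightarrow> ennreal" and ?P = "indicator P :: 'a \<Rightarrow> ennreal"
  have eX: "emeasure lborel X = ennreal (measure lborel X)"
    using fin by (intro emeasure_eq_ennreal_measure) auto
  have slice: "(\<integral>\<^sup>+x. ?P (x + b) \<partial>N) = ennreal (measure N {x. x + b \<in> P})" for b
  proof -
    have "(\<integral>\<^sup>+x. ?P (x + b) \<partial>N) = (\<integral>\<^sup>+x. indicator {x. x + b \<in> P} x \<partial>N)" by (simp add: indicator_def)
    also have "\<dots> = emeasure N {x. x + b \<in> P}"
      using translate_in_sets_borel(1)[OF P] by (intro nn_integral_indicator) simp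
    finally show ?thesis by (simp add: N.emeasure_eq_measure)
  qed
  have "ennreal (measure N P) * emeasure lborel X = (\<integral>\<^sup>+b. ennreal (measure N P) * ?X b \<partial>lborel)"
    by (simp add: nn_integral_cmult_indicator)
  also have "\<dots> \<le> (\<integral>\<^sup>+b. (\<integral>\<^sup>+x. ?X b * ?P (x + b) \<partial>N) + ennreal e * ?X b \<partial>lborel)"
  proof (rule nn_integral_mono)
    fix b
    have "ennreal (measure N P) \<le> ennreal (measure N {x. x + b \<in> P}) + ennreal e" if "b \<in> X"
      using ennreal_leI[OF shift[OF that]] nn by (simp add: ennreal_plus)
    then show "ennreal (measure N P) * ?X b \<le> (\<integral>\<^sup>+x. ?X b * ?P (x + b) \<partial>N) + ennreal e * ?X b"
      by (cases "b \<in> X") (simp_all add: slice)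
  qed
  also have "\<dots> = (\<integral>\<^sup>+b. \<integral>\<^sup>+x. ?X b * ?P (x + b) \<partial>N \<partial>lborel) + ennreal e * emeasure lborel X"
    by (subst nn_integral_add) (auto simp: nn_integral_cmult_indicator)
  also have "(\<integral>\<^sup>+b. \<integral>\<^sup>+x. ?X b * ?P (x + b) \<partial>N \<partial>lborel) = (\<integral>\<^sup>+x. \<integral>\<^sup>+b. ?X b * ?P (x + b) \<partial>lborel \<partial>N)"
    by (rule L.Fubini'[symmetric]) measurable
  also have "\<dots> \<le> (\<integral>\<^sup>+x. ennreal u * emeasure lborel X \<partial>N)"
  proof (rule nn_integral_mono)
    fix x
    have m: "{b. x + b \<in> P} \<inter> X \<in> sets lborel"
      using translate_in_sets_borel(2)[OF P] X by simp
    have "(\<integral>\<^sup>+b. ?X b * ?P (x + b) \<partial>lborel) = (\<integral>\<^sup>+b. indicator ({b. x + b \<in> P} \<inter> X) b \<partial>lborel)"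
      by (intro nn_integral_cong) (auto simp: indicator_def)
    also have "\<dots> = emeasure lborel ({b. x + b \<in> P} \<inter> X)" using m by (intro nn_integral_indicator)
    also have "\<dots> = ennreal (measure lborel ({b. x + b \<in> P} \<inter> X))"
      using emeasure_mono[of "{b. x + b \<in> P} \<inter> X" X lborel] fin
      by (intro emeasure_eq_ennreal_measure) (auto simp: top_unique)
    also have "\<dots> \<le> ennreal u * emeasure lborel X"
      using ennreal_leI[OF avg[of x]] nn by (simp add: eX ennreal_mult')
    finally show "(\<integral>\<^sup>+b. ?X b * ?P (x + b) \<partial>lborel) \<le> ennreal u * emeasure lborel X" .
  qed
  also have "\<dots> = ennreal u * emeasure lborel X" by (simp add: N.emeasure_space_1)
  finally have "ennreal (measure N P) * emeasure lborel X \<le> ennreal u * emeasure lborel X + ennreal e * emeasure lborel X"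
    by (simp add: add_right_mono)
  then have "ennreal (measure N P * measure lborel X) \<le> ennreal ((u + e) * measure lborel X)"
    using nn by (simp add: eX ennreal_mult' distrib_right ennreal_plus)
  then have "measure N P * measure lborel X \<le> (u + e) * measure lborel X"
    using nn by (subst (asm) ennreal_le_iff) auto
  then show ?thesis using pos by simp
qed

text \<open>The law barely changes under shifts from a box of rescaled side \<open>s / R\<close>.
  Averaging over that box sees the section only through its densities at scale \<open>s\<close>,
  since \<open>R * \<eta> = s\<close>.\<close>

lemma plane_section_difference_law_le:
  assumes A: "A \<in> sets borel" and sR: "s > 0" "R > 0" and u: "\<And>q. plane_density A q s \<le> u" and e: "e \<ge> 0"
    and shift: "\<And>b E. norm b < \<delta> \<Longrightarrow> E \<in> sets borel \<Longrightarrow>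
      measure kor_curve_difference_law E \<le> measure kor_curve_difference_law {x. x + b \<in> E} + e"
    and \<delta>: "s / R \<le> 1" "2 * (s / R) < \<delta>"
  shows "measure kor_curve_difference_law (plane_section A q R) \<le> u + e"
proof -
  define \<eta> where "\<eta> = s / R"
  have \<eta>: "\<eta> > 0" "\<eta> \<le> 1" "2 * \<eta> < \<delta>" "R * \<eta> = s" using sR \<delta> by (auto simp: \<eta>_def)
  define X where "X = {0..\<eta>} \<times> {0..\<eta>\<^sup>2}"
  have eX: "emeasure lborel X = ennreal (\<eta> ^ 3)"
    using \<eta> unfolding X_def by (subst emeasure_lborel_rectangle) (auto simp: power3_eq_cube power2_eq_square)
  then have mX: "measure lborel X = \<eta> ^ 3" using \<eta> by (simp add: measure_def)
  have u0: "u \<ge> 0" using u[of 0] plane_density_bounds(1)[of A 0 s] by linarith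
  show ?thesis
  proof (rule measure_le_shifted_average[where X = X])
    show "prob_space kor_curve_difference_law" by (rule prob_space_kor_curve_difference_law)
    show "sets kor_curve_difference_law = sets borel" by (rule sets_kor_curve_difference_law)
    show P: "plane_section A q R \<in> sets borel" by (rule plane_section_borel[OF A])
    show "X \<in> sets borel" unfolding X_def by (rule rectangle_borel)
    show "emeasure lborel X < \<infinity>" "0 < measure lborel X" using \<eta> by (simp_all add: eX mX)
    show "measure kor_curve_difference_law (plane_section A q R)
       \<le> measure kor_curve_difference_law {x. x + b \<in> plane_section A q R} + e" if "b \<in> X" for b
    proof (rule shift[OF _ P])
      have b: "0 \<le> fst b" "fst b \<le> \<eta>" "0 \<le> snd b" "snd b \<le> \<eta>\<^sup>2" using that by (auto simp: X_def)
      \<comment> \<open>Both sides of the box are then at most \<open>\<eta>\<close>, so its points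
        have norm at most \<open>2 * \<eta>\<close>.\<close>
      have "\<eta>\<^sup>2 \<le> \<eta>" using \<eta> by (simp add: power2_eq_square mult_left_le)
      then show "norm b < \<delta>" using norm_Pair_le[of "fst b" "snd b"] b \<eta> by simp
    qed
    show "measure lborel ({b. x + b \<in> plane_section A q R} \<inter> X) \<le> u * measure lborel X" for x
      unfolding plane_section_translate X_def measure_plane_section_rectangle[OF A \<eta>(1)] \<eta>(4)
      using u \<eta> mX by (simp add: X_def mult.commute)
  qed (use e u0 in auto)
qed

section \<open>The contradiction inside a single coset\<close>

lemma kor_dist_plane_kor_curve:
  assumes "0 < R" "0 < x" "x < 1"
  shows "kor_dist (heis_mult q (heis_plane (par_dil R (p + kor_curve x)))) (heis_mult q (heis_plane (par_dil R p))) = R"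
proof -
  have "x ^ 4 \<le> 1" using assms by (simp add: power_le_one)
  then have "(R * x) ^ 4 + (R\<^sup>2 * kor_profile x)\<^sup>2 = R ^ 4"
    by (simp add: kor_profile_def power_mult_distrib power_mult[symmetric] algebra_simps)
  then have "kor_dist (heis_mult q (heis_plane (par_dil R (p + kor_curve x)))) (heis_mult q (heis_plane (par_dil R p))) = root 4 (R ^ 4)"
    by (simp add: kor_dist_heis_plane par_dil_add) (simp add: par_dil_def kor_curve_def)
  also have "\<dots> = R" using assms by (intro real_root_power_cancel) auto
  finally show ?thesis .
qed

text \<open>Up to errors the hypotheses say \<open>D \<le> D * (1 - D)\<close>; \<open>e\<close> and
  \<open>L\<close> are chosen so that all errors together stay below
  \<open>D\<^sup>2\<close>.\<close>

lemma density_contradiction: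
  fixes D :: real
  assumes D: "0 < D" "D \<le> 1" and e: "e = D\<^sup>2 / 8" and L: "L = 1 + 3 / e" and m: "L ^ 3 * (D - e) \<le> m"
    and le: "m \<le> (D + 2 * e) * ((L + 1) * (L\<^sup>2 + 1) - m)"
  shows False
proof -
  have e0: "e > 0" using D by (simp add: e)
  have L1: "L \<ge> 1" "e * L = e + 3" using e0 by (simp_all add: L algebra_simps)
  \<comment> \<open>The choice of \<open>L\<close> makes the volume added by enlarging the box,
    \<open>L\<^sup>2 + L + 1\<close>, at most \<open>3 * L\<^sup>2\<close> and hence at most
    \<open>e * L ^ 3\<close>.\<close>
  have "e * L ^ 3 = (e * L) * L\<^sup>2" by (simp add: power3_eq_cube power2_eq_square)
  also have "\<dots> = (e + 3) * L\<^sup>2" by (simp only: L1)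
  also have "\<dots> \<ge> 3 * L\<^sup>2" using e0 by (intro mult_right_mono) auto
  finally have "3 * L\<^sup>2 \<le> e * L ^ 3" .
  moreover have "L * 1 \<le> L * L" "1 * 1 \<le> L * L" using L1 by (intro mult_mono; simp)+
  then have "L \<le> L\<^sup>2" "1 \<le> L\<^sup>2" by (simp_all add: power2_eq_square)
  moreover have "(L + 1) * (L\<^sup>2 + 1) = L ^ 3 + L\<^sup>2 + L + 1"
    by (simp add: algebra_simps power3_eq_cube power2_eq_square)
  moreover have "L ^ 3 * (1 + e) = L ^ 3 + e * L ^ 3" by (simp add: algebra_simps)
  ultimately have "(L + 1) * (L\<^sup>2 + 1) \<le> L ^ 3 * (1 + e)" by linarith
  then have "(D + 2 * e) * ((L + 1) * (L\<^sup>2 + 1)) \<le> (D + 2 * e) * (L ^ 3 * (1 + e))"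
    using D e0 by (intro mult_left_mono) auto
  moreover have "(L ^ 3 * (D - e)) * (1 + (D + 2 * e)) \<le> m * (1 + (D + 2 * e))"
    using m D e0 by (intro mult_right_mono) auto
  moreover have "m * (1 + (D + 2 * e)) \<le> (D + 2 * e) * ((L + 1) * (L\<^sup>2 + 1))"
  proof -
    have *: "m * (1 + U) = m + U * m" "U * (X - m) = U * X - U * m" for U X :: real
      by (simp_all add: algebra_simps)
    show ?thesis using le unfolding * by linarith
  qed
  ultimately have "L ^ 3 * ((D - e) * (1 + (D + 2 * e))) \<le> L ^ 3 * ((D + 2 * e) * (1 + e))"
    by (simp only: mult.assoc mult.left_commute[of _ "L ^ 3"])
  moreover have "L ^ 3 > 0" using L1 by simp
  ultimately have "(D - e) * (1 + (D + 2 * e)) \<le> (D + 2 * e) * (1 + e)"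
    by (simp only: mult_le_cancel_left_pos)
  moreover have "(D - e) * (1 + (D + 2 * e)) = D + D\<^sup>2 + e * D - e - 2 * (e * e)"
    "(D + 2 * e) * (1 + e) = D + 2 * e + e * D + 2 * (e * e)"
    by (simp_all add: algebra_simps power2_eq_square)
  ultimately have "D\<^sup>2 \<le> 3 * e + 4 * (e * e)" by linarith
  \<comment> \<open>Since \<open>e\<close> is at most 1/8, the quadratic error is at most
    \<open>e / 2\<close>. The total is 7/2 times \<open>e\<close>, whereas \<open>D\<^sup>2\<close>
    is 8 times \<open>e\<close>.\<close>
  moreover have "D\<^sup>2 \<le> 1" using D by (simp add: power_le_one)
  then have "e * e \<le> e * (1 / 8)" using e0 by (intro mult_left_mono) (auto simp: e)
  ultimately show False using e0 e by linarith
qed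

lemma all_large_kor_distances:
  fixes A :: "'n::finite heis set"
  assumes A: "A \<in> sets borel" and d0: "d0 > 0" and dense: "\<And>S. S > 0 \<Longrightarrow> \<exists>q. d0 \<le> plane_density A q S"
  shows "\<exists>R0>0. \<forall>R\<ge>R0. \<exists>x\<in>A. \<exists>y\<in>A. kor_dist x y = R"
proof -
  define d where "d S = (SUP q. plane_density A q S)" for S
  have bdd: "bdd_above (range (\<lambda>q. plane_density A q S))" for S
    using plane_density_bounds(2)[of A] by (intro bdd_aboveI[of _ 1]) auto
  have dup: "plane_density A q S \<le> d S" for q S
    unfolding d_def by (intro cSUP_upper bdd) auto
  have dge: "d0 \<le> d S" if "S > 0" for S
    using dense[OF that] dup order_trans by blast
  \<comment> \<open>As an infimum, \<open>D\<close> bounds the best density from below at every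
    scale and is nearly attained at some scale \<open>s\<close>; both facts are combined
    below.\<close>
  define D where "D = (INF S\<in>{0<..}. d S)"
  have bddb: "bdd_below (d ` {0<..})" using dge by (intro bdd_belowI[of _ d0]) auto
  have "d0 \<le> D" unfolding D_def using dge by (intro cINF_greatest) auto
  then have D0: "D > 0" using d0 by linarith
  have Dle: "D \<le> d S" if "S > 0" for S unfolding D_def using that by (intro cINF_lower bddb) auto
  have "d 1 \<le> 1" unfolding d_def using plane_density_bounds(2)[of A] by (intro cSUP_least) auto
  then have D1: "D \<le> 1" using Dle[of 1] by simp
  define e where "e = D\<^sup>2 / 8"
  have e: "e > 0" using D0 by (simp add: e_def)
  have "Inf (d ` {0<..}) < D + e" using e by (simp add: D_def)
  then obtain s where s: "s > 0" "d s < D + e"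
    using cInf_lessD[of "d ` {0<..}" "D + e"] by auto
  obtain \<delta> where \<delta>: "\<delta> > 0" "\<And>b E. norm b < \<delta> \<Longrightarrow> E \<in> sets borel \<Longrightarrow>
      measure kor_curve_difference_law E \<le> measure kor_curve_difference_law {x. x + b \<in> E} + e"
    using absolutely_continuous_translate[OF prob_space.finite_measure[OF prob_space_kor_curve_difference_law]
        sets_kor_curve_difference_law absolutely_continuous_kor_curve_difference_law e]
    by blast
  \<comment> \<open>The first entry gives \<open>s / R \<le> 1\<close>, the second bounds
    \<open>2 * (s / R)\<close> by half of \<open>\<delta>\<close>.\<close>
  define R0 where "R0 = max s (4 * s / \<delta>)"
  show ?thesis
  proof (intro exI[of _ R0] conjI allI impI)
    show "R0 > 0" using s by (simp add: R0_def)
    fix R assume R: "R0 \<le> R"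
    have R0: "R > 0" using R s by (simp add: R0_def)
    have sR: "s / R \<le> 1" using R R0 by (simp add: R0_def)
    have "4 * s \<le> R * \<delta>" using R \<delta>(1) by (simp add: R0_def pos_divide_le_eq)
    then have sR2: "2 * (s / R) < \<delta>" using R0 s \<delta>(1) by (simp add: pos_divide_less_eq mult.commute)
    \<comment> \<open>The density bound at the single scale \<open>s\<close> becomes a bound for all
      sections at every large scale \<open>R\<close>.\<close>
    have law: "measure kor_curve_difference_law (plane_section A q R) \<le> D + 2 * e" for q
      using plane_section_difference_law_le[OF A s(1) R0 dup[of _ s] less_imp_le[OF e] \<delta>(2) sR sR2, of q] s(2) by linarith
    define L where "L = 1 + 3 / e"
    have L: "L > 0" using e by (simp add: L_def add_pos_pos)
    \<comment> \<open>The infimum is used at the scale \<open>R * L\<close>, which yields a coset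
      whose section is dense in the large box.\<close>
    have "D - e < d (R * L)" using Dle[OF mult_pos_pos[OF R0 L]] e by linarith
    then obtain q where q: "D - e < plane_density A q (R * L)"
      unfolding d_def using less_cSUP_iff[OF _ bdd, of "D - e"] by auto
    define E where "E = plane_section A q R \<inter> {0..L} \<times> {0..L\<^sup>2}"
    \<comment> \<open>The arc has coordinates in [0,1], so a point shifted into \<open>E\<close>
      lies at most 1 to the left of the box and at most 1 below it.\<close>
    define C where "C = {-1..L} \<times> {-1..L\<^sup>2}"
    have mE: "measure lborel E = L ^ 3 * plane_density A q (R * L)"
      unfolding E_def by (rule measure_plane_section_rectangle[OF A L])
    have eC: "emeasure lborel C = ennreal ((L + 1) * (L\<^sup>2 + 1))"
    proof -
      have "- 1 \<le> L" "- 1 \<le> L\<^sup>2" using L zero_le_power2[of L] by linarith+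
      from emeasure_lborel_rectangle[OF this] show ?thesis by (simp only: C_def diff_minus_eq_add)
    qed
    show "\<exists>x\<in>A. \<exists>y\<in>A. kor_dist x y = R"
    proof (rule ccontr)
      assume no: "\<not> ?thesis"
      have "measure lborel E \<le> (D + 2 * e) * (measure lborel C - measure lborel E)"
      proof (rule measure_avoiding_shifts[OF prob_space_unit_uniform kor_curve_measurable_unit_uniform])
        show "E \<in> sets borel" unfolding E_def by (intro sets.Int plane_section_borel[OF A] rectangle_borel)
        show "C \<in> sets borel" unfolding C_def by (rule rectangle_borel)
        show "emeasure lborel C < \<infinity>" by (simp add: eC)
        show "E \<subseteq> C" using L by (auto simp: E_def C_def)
        show "D + 2 * e > 0" using D0 e by simp
        interpret \<nu>: prob_space kor_curve_difference_law by (rule prob_space_kor_curve_difference_law)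
        show "measure (distr (unit_uniform \<Otimes>\<^sub>M unit_uniform) borel (\<lambda>z. kor_curve (snd z) - kor_curve (fst z)))
            {w. p + w \<in> E} \<le> D + 2 * e" for p
        proof -
          have "measure kor_curve_difference_law {w. p + w \<in> E} \<le> measure kor_curve_difference_law {w. p + w \<in> plane_section A q R}"
            using translate_in_sets_borel(2)[OF plane_section_borel[OF A]]
            by (intro \<nu>.finite_measure_mono) (auto simp: E_def sets_kor_curve_difference_law)
          also have "\<dots> \<le> D + 2 * e" unfolding plane_section_translate by (rule law)
          finally show ?thesis by (simp add: kor_curve_difference_law_def)
        qed
        fix p x assume "x \<in> space unit_uniform"
        then have x: "0 < x" "x < 1" by (auto simp: space_restrict_space)
        show "p + kor_curve x \<notin> E" if "p \<in> E"
        proof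
          assume "p + kor_curve x \<in> E"
          then have "heis_mult q (heis_plane (par_dil R (p + kor_curve x))) \<in> A"
            "heis_mult q (heis_plane (par_dil R p)) \<in> A"
            using that by (auto simp: E_def plane_section_def)
          then show False using no kor_dist_plane_kor_curve[OF R0 x, of q p] by blast
        qed
        have kp: "0 \<le> kor_profile x" "kor_profile x \<le> 1" using kor_profile_bounds[of x] x by linarith+
        show "p \<in> C" if "p + kor_curve x \<in> E"
        proof -
          have "0 \<le> fst p + x" "fst p + x \<le> L" "0 \<le> snd p + kor_profile x" "snd p + kor_profile x \<le> L\<^sup>2"
            using that by (auto simp: E_def kor_curve_def mem_Times_iff)
          then show ?thesis using x kp by (simp add: C_def mem_Times_iff)
        qed
      qed
      moreover have "measure lborel C = (L + 1) * (L\<^sup>2 + 1)"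
        using L eC by (simp add: measure_def)
      moreover have "L ^ 3 * (D - e) \<le> measure lborel E" unfolding mE using q L by (intro mult_left_mono) auto
      ultimately show False using density_contradiction[OF D0 D1 e_def L_def] by metis
    qed
  qed
qed

section \<open>Reduction to Borel sets and to coset densities\<close>

theorem theorem1p1:
  fixes A :: "('n::finite) heis set"
  assumes "A \<in> sets lebesgue"
    and "Limsup at_top (\<lambda>R::real. SUP x. ereal (measure lebesgue (A \<inter> kor_ball x R)
            / measure lebesgue (kor_ball x R))) > 0"
  shows "\<exists>R0>0. \<forall>R\<ge>R0. \<exists>x\<in>A. \<exists>y\<in>A. kor_dist x y = R"
proof -
  \<comment> \<open>\<open>B\<close> is a Borel subset of \<open>A\<close> with negligible
    remainder: densities agree, and pairs found in \<open>B\<close> lie in \<open>A\<close>.\<close>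
  obtain B N N' where B: "A = B \<union> N" "N \<subseteq> N'" "N' \<in> null_sets lborel" "B \<in> sets lborel"
    using sets_completionE[OF assms(1)] by blast
  then have Bb: "B \<in> sets borel" by simp
  have ball: "measure lebesgue (kor_ball x R) = measure lborel (kor_ball x R)" for x :: "'n heis" and R
    using kor_ball_borel[of x R] by (simp add: measure_completion)
  have AB: "measure lebesgue (A \<inter> kor_ball x R) = measure lborel (B \<inter> kor_ball x R)" for x R
  proof -
    have s: "B \<inter> kor_ball x R \<in> sets lborel" using B(4) kor_ball_borel[of x R] by simp
    have "N \<inter> kor_ball x R \<in> null_sets lebesgue"
      by (rule null_sets_completion_subset[OF _ null_sets_completionI[OF B(3)]]) (use B(2) in blast)
    then have "measure lebesgue ((B \<inter> kor_ball x R) \<union> (N \<inter> kor_ball x R)) = measure lebesgue (B \<inter> kor_ball x R)"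
      using s by (intro measure_Un_null_set) auto
    then show ?thesis using s by (simp add: B(1) Int_Un_distrib2 measure_completion)
  qed
  obtain c where c: "0 < c" "ereal c < Limsup at_top (\<lambda>R::real. SUP x. ereal (measure lebesgue (A \<inter> kor_ball x R)
            / measure lebesgue (kor_ball x R)))"
    using ereal_dense2[OF assms(2)] by auto
  \<comment> \<open>A positive upper limit exceeds \<open>c\<close>, so density above
    \<open>c\<close> recurs in arbitrarily large balls.\<close>
  have big: "\<exists>R\<ge>S. \<exists>x. c < measure lborel (B \<inter> kor_ball x R) / measure lborel (kor_ball x R)" for S
  proof (rule ccontr)
    assume "\<not> ?thesis"
    then have "\<forall>\<^sub>F R in at_top. (SUP x. ereal (measure lebesgue (A \<inter> kor_ball x R) / measure lebesgue (kor_ball x R))) \<le> ereal c"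
      unfolding eventually_at_top_linorder AB ball by (intro exI[of _ S]) (auto intro!: SUP_least simp: not_less)
    from Limsup_bounded[OF this] show False using c(2) by simp
  qed
  define K where "K = (4::real) ^ (DIM(complex ^ 'n) + 2)"
  have K: "K > 0" by (simp add: K_def)
  \<comment> \<open>The factor 2 turns the transfer inequality into \<open>c \<le> c / 2\<close> if
    every coset box is too sparse.\<close>
  have "\<exists>q. c / (2 * K) \<le> plane_density B q S" if S: "S > 0" for S
  proof (rule ccontr)
    assume "\<not> ?thesis"
    then have le: "plane_density B q S \<le> c / (2 * K)" for q by (meson linear)
    obtain R x where R: "S \<le> R" "c < measure lborel (B \<inter> kor_ball x R) / measure lborel (kor_ball x R)"
      using big by blast
    have "c * measure lborel (kor_ball x R) \<le> measure lborel (B \<inter> kor_ball x R)"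
    proof -
      \<comment> \<open>With a zero denominator the quotient would be 0 and could not exceed
        \<open>c\<close>.\<close>
      have "measure lborel (kor_ball x R) \<noteq> 0"
        using R(2) c(1) by force
      then have "measure lborel (kor_ball x R) > 0" using measure_nonneg[of lborel "kor_ball x R"] by linarith
      then show ?thesis using R(2) by (simp only: pos_less_divide_eq less_imp_le)
    qed
    from plane_density_lower_bound[OF Bb S R(1) this less_imp_le[OF c(1)] le]
    have "c \<le> K * (c / (2 * K))" by (simp add: K_def)
    then show False using c(1) K by simp
  qed
  from all_large_kor_distances[OF Bb _ this] c(1) K obtain R0 where
    "R0 > 0" "\<forall>R\<ge>R0. \<exists>x\<in>B. \<exists>y\<in>B. kor_dist x y = R" by auto
  then show ?thesis using B(1) by blast
qed

end
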